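(* For each $\lambda\in(0,1]$ let $(\phi_\lambda,\nu_\lambda)$ be a limiting solution pair of relative height $\lambda$ (as defined in the context), and let $\varphi_\lambda=\phi_\lambda+1-\nu_\lambda$, $\mu_\lambda=2-\nu_\lambda$ be the corresponding solitary solution of the steady Whitham equation and its wave speed. Then the map $$(0,1]\ni\lambda\mapsto(\varphi_\lambda,\mu_\lambda)\in C(\mathbb{R})\times\mathbb{R}$$ is injective.
   Context: Let $m(\xi)=\sqrt{\tanh(\xi)/\xi}$ (with $m(0)=1$) and let $K(x)=\frac{1}{2\pi}\int_{\mathbb{R}}m(\xi)e^{ix\xi}\,d\xi$ be the Whitham kernel; $K$ is even, positive, and integrable with $\|K\|_{L^1(\mathbb{R})}=1$. Let $Lf=K\ast f$. The steady Whitham equation with wave speed $\mu$ is $-\mu\varphi+L\varphi+\varphi^2=0$, required to hold pointwise in $\mathbb{R}$; then $(\varphi,\mu)$ is called a solution pair. Admissible periodic solution pairs: for finite $P>0$ and $\lambda\in(0,1]$, an admissible $P$-periodic solution pair of relative height $\lambda$ is a pair $(\varphi_{P,\lambda},\mu_{P,\lambda})$ such that $\varphi_{P,\lambda}\in C^{1/2}(\mathbb{R})$ (Hölder space) is a $P$-periodic solution of the steady Whitham equation with wave speed $\mu_{P,\lambda}$; $0<\mu_{P,\lambda}\le1$; $\mu_{P,\lambda}-1\le\varphi_{P,\lambda}\le\varphi_{P,\lambda}(0)=\frac{\lambda\mu_{P,\lambda}}{2}$; $\varphi_{P,\lambda}$ is even, strictly increasing on $(-P/2,0)$ and smooth on $\mathbb{R}\setminus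 P\mathbb{Z}$; and $\varphi_{P,\lambda}\in C^\infty(\mathbb{R})$ if $\lambda\in(0,1)$. (Such pairs are known to exist for every $P>0$ and $\lambda\in(0,1]$ by earlier work of Ehrnström and Wahlén.) Limiting solution pairs: a limiting solution pair of relative height $\lambda$ is a pair $(\phi_\lambda,\nu_\lambda)\in C(\mathbb{R})\times[0,1]$ which is the limit, locally uniformly on $\mathbb{R}$ in the first component, of a sequence of admissible $P_n$-periodic solution pairs of relative height $\lambda$ with $P_n\to\infty$. It is known that every such pair solves the steady Whitham equation with wave speed $\nu_\lambda$ and has $\phi_\lambda(0)=\lambda\nu_\lambda/2$, and that the transformed pair $(\varphi_\lambda,\mu_\lambda)=(\phi_\lambda+1-\nu_\lambda,\,2-\nu_\lambda)$ is a positive, even, continuous solution of the steady Whitham equation with $\mu_\lambda\in(1,2)$, strictly decreasing on $(0,\infty)$, tending to $0$ at $\pm\infty$, with $\varphi_\lambda(0)=\mu_\lambda-1+\lambda(1-\frac{\mu_\lambda}{2})$. *)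

theory Defs
  imports "HOL-Analysis.Analysis"
begin

definition whitham_symbol :: "real \<Rightarrow> real" where
  "whitham_symbol \<xi> = (if \<xi> = 0 then 1 else sqrt (tanh \<xi> / \<xi>))"

text \<open>
  The symbol decays only like \<open>\<bar>\<xi>\<bar> powr (-1/2)\<close>, so the inverse Fourier integral is not
  absolutely convergent and the Lebesgue integral cannot be used here. The gauge integral over
  \<open>UNIV\<close> is the limit of the integrals over growing compact intervals, and it exists
  for every \<open>x \<noteq> 0\<close>. At \<open>x = 0\<close> the integral diverges and the value
  below is a dummy; this does not affect the convolution with the kernel. The integral is real
  because the symbol is even, so \<open>Re\<close> only changes the type.
\<close>

definition whitham_kernel :: "real \<Rightarrow> real" where
  "whitham_kernel x =
     Re (1 / (2 * of_real pi) *
         integral UNIV (\<lambda>\<xi>::real. of_real (whitham_symbol \<xi>) * exp (\<i> * of_real (x * \<xi>))))"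

definition whitham_op :: "(real \<Rightarrow> real) \<Rightarrow> real \<Rightarrow> real" where
  "whitham_op f x = (LINT y|lborel. whitham_kernel (x - y) * f y)"

definition steady_whitham :: "(real \<Rightarrow> real) \<Rightarrow> real \<Rightarrow> bool" where
  "steady_whitham f \<mu> \<longleftrightarrow> (\<forall>x. - \<mu> * f x + whitham_op f x + (f x)\<^sup>2 = 0)"

definition hoelder_space :: "real \<Rightarrow> (real \<Rightarrow> real) set" where
  "hoelder_space \<alpha> =
     {f. bounded (range f) \<and> (\<exists>C. \<forall>x y. \<bar>f x - f y\<bar> \<le> C * \<bar>x - y\<bar> powr \<alpha>)}"

text \<open>Intended for open \<open>S\<close> only.\<close>

definition smooth_on :: "real set \<Rightarrow> (real \<Rightarrow> real) \<Rightarrow> bool" where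
  "smooth_on S f \<longleftrightarrow> (\<forall>k. (deriv ^^ k) f differentiable_on S)"

definition admissible_pair :: "real \<Rightarrow> real \<Rightarrow> (real \<Rightarrow> real) \<Rightarrow> real \<Rightarrow> bool" where
  "admissible_pair P \<eta> f \<mu> \<longleftrightarrow>
     0 < P \<and> 0 < \<eta> \<and> \<eta> \<le> 1 \<and>
     f \<in> hoelder_space (1/2) \<and>
     (\<forall>x. f (x + P) = f x) \<and>
     steady_whitham f \<mu> \<and>
     0 < \<mu> \<and> \<mu> \<le> 1 \<and>
     (\<forall>x. \<mu> - 1 \<le> f x \<and> f x \<le> f 0) \<and> f 0 = \<eta> * \<mu> / 2 \<and>
     (\<forall>x. f (- x) = f x) \<and>
     strict_mono_on {- P / 2 <..< 0} f \<and>
     smooth_on (UNIV - range (\<lambda>k::int. of_int k * P)) f \<and>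
     (\<eta> < 1 \<longrightarrow> smooth_on UNIV f)"

definition limiting_pair :: "real \<Rightarrow> (real \<Rightarrow> real) \<Rightarrow> real \<Rightarrow> bool" where
  "limiting_pair \<eta> \<phi> \<nu> \<longleftrightarrow>
     continuous_on UNIV \<phi> \<and> 0 \<le> \<nu> \<and> \<nu> \<le> 1 \<and>
     (\<exists>P f \<mu>. (\<forall>n::nat. admissible_pair (P n) \<eta> (f n) (\<mu> n)) \<and>
        filterlim P at_top sequentially \<and>
        (\<forall>C. compact C \<longrightarrow> uniform_limit C f \<phi> sequentially) \<and>
        \<mu> \<longlonglongrightarrow> \<nu>)"

end

theory Submission
  imports Defs "HOL-Complex_Analysis.Cauchy_Integral_Theorem"
begin

text \<open>
  A limiting pair of relative height \<open>\<eta>\<close> satisfies \<open>\<phi> 0 = \<eta> * \<nu> / 2\<close>, by passing to the limit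
  in the crest condition (\<open>limiting_value_at_0\<close>). Hence \<open>(\<phi>, \<nu>)\<close> determines \<open>\<eta>\<close> as soon as
  \<open>\<nu> \<noteq> 0\<close>, and injectivity amounts to the positivity of \<open>\<nu>\<close>. The danger is that the speeds
  of the approximating periodic waves tend to \<open>0\<close>; this is excluded by a bound
  \<open>\<mu> \<ge> c > 0\<close> that is uniform in all waves of period at least \<open>8\<close>
  (\<open>admissible_speed_lower_bound\<close>).

  The bound compares two translates of a wave \<open>f\<close>. Put
  \<open>e(q) = f(q - 1/2) - f(q + 1/2)\<close>. Because \<open>f\<close> is even, periodic and decreasing on a half period,
  \<open>e\<close> is odd, periodic and nonnegative on \<open>[0, P/2]\<close>. Subtracting the steady equation at
  \<open>p + 1/2\<close> from the one at \<open>p - 1/2\<close> gives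
  \<open>(\<mu> - f(p - 1/2) - f(p + 1/2)) * e(p) = L e(p)\<close>. If \<open>L e(p) \<ge> c * e(p)\<close> holds at the
  minimum point \<open>p\<close> of \<open>e\<close> on \<open>[1, 2]\<close>, with \<open>c > 0\<close> independent of the wave
  (\<open>whitham_op_odd_periodic_ge\<close>), division by \<open>e(p) > 0\<close> yields \<open>c \<le> \<mu> - 2 * f(3)\<close>
  (\<open>speed_ge_coercivity\<close>). On the other hand \<open>L f(0) = f(0) * (\<mu> - f(0)) \<ge> 0\<close> while
  \<open>f \<le> \<mu>/2\<close>, so \<open>f\<close> cannot be very negative on \<open>[3, 4]\<close>: \<open>f(3) \<ge> - C * \<mu>\<close>
  (\<open>admissible_value_at_3_ge\<close>). Together, \<open>c \<le> (1 + 2 * C) * \<mu>\<close>.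

  The coercivity estimate rests on the representation of the kernel as a Laplace transform,
  \<open>K(x) = \<integral> \<sigma>(s) exp(- s \<bar>x\<bar>) ds\<close> with \<open>\<sigma> \<ge> 0\<close> (\<open>whitham_kernel_eq_laplace\<close>). It comes from
  turning the Fourier integral of \<open>sqrt (tanh z / z)\<close> from the positive real axis onto the positive
  imaginary axis, where \<open>tanh (\<i> y) / (\<i> y) = tan y / y\<close> is real: the real part of the
  resulting integral sees exactly the intervals on which \<open>tan y\<close> is negative.
  So \<open>L\<close> is a positive superposition of convolutions with \<open>exp(- s \<bar>x\<bar>)\<close>, and on odd periodic
  functions each of these has an explicit positive Green kernel on \<open>[0, P/2]\<close>
  (\<open>resolvent_op_odd_periodic_ge\<close>).
\<close>

section \<open>The function tanh z / z on the right half-plane\<close>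

lemma Re_sinh_complex: "Re (sinh z) = sinh (Re z) * cos (Im z)"
  and Im_sinh_complex: "Im (sinh z) = cosh (Re z) * sin (Im z)"
  and Re_cosh_complex: "Re (cosh z) = cosh (Re z) * cos (Im z)"
  and Im_cosh_complex: "Im (cosh z) = sinh (Re z) * sin (Im z)"
  by (simp_all add: sinh_field_def cosh_field_def Re_exp Im_exp field_simps)

lemma norm_sinh_complex_power2: "(norm (sinh z))\<^sup>2 = (sinh (Re z))\<^sup>2 + (sin (Im z))\<^sup>2"
proof -
  have "(norm (sinh z))\<^sup>2 = (sinh (Re z))\<^sup>2 * (cos (Im z))\<^sup>2 + (cosh (Re z))\<^sup>2 * (sin (Im z))\<^sup>2"
    by (simp add: cmod_power2 Re_sinh_complex Im_sinh_complex power_mult_distrib)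
  also have "\<dots> = (sinh (Re z))\<^sup>2 * ((sin (Im z))\<^sup>2 + (cos (Im z))\<^sup>2) + (sin (Im z))\<^sup>2"
    unfolding cosh_square_eq by (simp only: algebra_simps)
  finally show ?thesis by simp
qed

lemma norm_cosh_complex_power2: "(norm (cosh z))\<^sup>2 = (sinh (Re z))\<^sup>2 + (cos (Im z))\<^sup>2"
proof -
  have "(norm (cosh z))\<^sup>2 = (cosh (Re z))\<^sup>2 * (cos (Im z))\<^sup>2 + (sinh (Re z))\<^sup>2 * (sin (Im z))\<^sup>2"
    by (simp add: cmod_power2 Re_cosh_complex Im_cosh_complex power_mult_distrib)
  also have "\<dots> = (sinh (Re z))\<^sup>2 * ((sin (Im z))\<^sup>2 + (cos (Im z))\<^sup>2) + (cos (Im z))\<^sup>2"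
    unfolding cosh_square_eq by (simp only: algebra_simps)
  finally show ?thesis by simp
qed

lemma cosh_complex_nonzero:
  assumes "0 < Re z"
  shows "cosh z \<noteq> 0"
proof
  assume "cosh z = 0"
  then have "(sinh (Re z))\<^sup>2 + (cos (Im z))\<^sup>2 = 0"
    using norm_cosh_complex_power2[of z] by simp
  then have "sinh (Re z) = 0"
    by (simp add: sum_power2_eq_zero_iff)
  then show False using assms by simp
qed

text \<open>
  Up to a positive factor, \<open>Im (tanh z / z)\<close> is \<open>x sin y cos y - y sinh x cosh x\<close> for
  \<open>z = x + \<i> y\<close>, and \<open>sin y cos y \<le> y\<close> while \<open>sinh x cosh x > x\<close>. The sign decides from
  which side of the slit \<open>tanh z / z\<close> approaches its values on the imaginary axis, hence which
  branch of the square root is seen there.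
\<close>

lemma Im_tanh_over_id_neg:
  assumes "0 < Re z" "0 < Im z"
  shows "Im (tanh z / z) < 0"
proof -
  define x y where "x = Re z" and "y = Im z"
  have xy: "x > 0" "y > 0" using assms by (auto simp: x_def y_def)
  have z: "z \<noteq> 0" using assms by auto
  have c: "cosh z \<noteq> 0" using cosh_complex_nonzero assms by blast
  have "tanh z / z = sinh z / (cosh z * z)"
    by (simp add: tanh_def)
  also have "\<dots> = (sinh z * cnj (cosh z * z)) / of_real ((norm (cosh z * z))\<^sup>2)"
    using complex_div_cnj[of "sinh z" "cosh z * z"] by simp
  also have "Im \<dots> = Im (sinh z * cnj (cosh z * z)) / (norm (cosh z * z))\<^sup>2"
    by (rule Im_divide_of_real)
  finally have eq: "Im (tanh z / z) = Im (sinh z * cnj (cosh z * z)) / (norm (cosh z * z))\<^sup>2" .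
  have "Im (sinh z * cnj (cosh z * z)) = x * (sin y * cos y) * ((cosh x)\<^sup>2 - (sinh x)\<^sup>2)
       - y * (sinh x * cosh x) * ((sin y)\<^sup>2 + (cos y)\<^sup>2)"
    by (simp add: Re_sinh_complex Im_sinh_complex Re_cosh_complex Im_cosh_complex
        x_def[symmetric] y_def[symmetric] algebra_simps power2_eq_square del: sin_cos_squared_add3)
  also have "\<dots> = x * (sin y * cos y) - y * (sinh x * cosh x)"
    using hyperbolic_pythagoras[of x] by simp
  also have "\<dots> < 0"
  proof -
    have "sin y * cos y \<le> y"
      using sin_x_le_x[of "2*y"] xy sin_double[of y] by simp
    then have 1: "x * (sin y * cos y) \<le> x * y" using xy by simp
    have "x \<le> sinh x" using real_le_x_sinh[of x] xy by (simp add: sinh_field_def exp_minus)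
    moreover have "1 < cosh x" using cosh_real_ge_1[of x] cosh_real_one_iff[of x] xy by linarith
    then have "sinh x < sinh x * cosh x" using xy by simp
    ultimately have "x < sinh x * cosh x" by linarith
    then have "y * x < y * (sinh x * cosh x)" using xy by simp
    with 1 show ?thesis by (simp add: mult.commute)
  qed
  finally show ?thesis
    unfolding eq using z c by (simp add: divide_neg_pos)
qed

text \<open>
  This makes the principal square root of \<open>tanh z / z\<close> holomorphic on the right half-plane.
\<close>

lemma tanh_over_id_off_slit:
  assumes "0 < Re z"
  shows "tanh z / z \<notin> \<real>\<^sub>\<le>\<^sub>0"
proof -
  consider "Im z > 0" | "Im z < 0" | "Im z = 0" by linarith
  then show ?thesis
  proof cases
    case 1
    then show ?thesis using Im_tanh_over_id_neg[of z] assms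
      by (auto simp: complex_nonpos_Reals_iff)
  next
    case 2
    have "tanh (cnj z) / cnj z = cnj (tanh z / z)"
      by (simp add: tanh_def sinh_field_def cosh_field_def exp_cnj)
    moreover have "Im (tanh (cnj z) / cnj z) < 0"
      using Im_tanh_over_id_neg[of "cnj z"] assms 2 by simp
    ultimately have "Im (cnj (tanh z / z)) < 0" by metis
    then have "Im (tanh z / z) > 0" unfolding cnj.simps by linarith
    then show ?thesis by (auto simp: complex_nonpos_Reals_iff)
  next
    case 3
    then obtain x where x: "z = of_real x" "x > 0"
      using assms by (metis complex_is_Real_iff of_real_Re)
    have "tanh z / z = of_real (tanh x / x)"
      by (simp add: x tanh_def sinh_field_def cosh_field_def flip: exp_of_real)
    moreover have "0 < tanh x / x" using x by simp
    ultimately show ?thesis by (simp add: complex_nonpos_Reals_iff not_le)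
  qed
qed

text \<open>
  The next three bounds control the vertical edge near the imaginary axis, the far vertical edge
  and the top edge of a rectangle. The first one is uniform for \<open>0 < Re z \<le> 1\<close> and degenerates only
  at the zeros of the cosine, where its square root is integrable. The last one takes the height to
  be a multiple of \<open>pi\<close>, so that the edge stays away from the poles of the hyperbolic tangent.
\<close>

lemma norm_tanh_over_id_le_near_axis:
  assumes "0 < Re z" "Re z \<le> 1"
  shows "norm (tanh z / z) * \<bar>cos (Im z)\<bar> \<le> 2"
proof -
  have z: "z \<noteq> 0" using assms by auto
  have c: "cosh z \<noteq> 0" using cosh_complex_nonzero assms by blast
  have s: "sinh (Re z) \<le> 2 * Re z"
  proof -
    have "exp (Re z) \<le> 1 + Re z + (Re z)\<^sup>2" using exp_bound assms by simp
    moreover have "1 - Re z \<le> exp (- Re z)" using exp_ge_add_one_self[of "- Re z"] by simp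
    moreover have "(Re z)\<^sup>2 \<le> Re z" using assms by (simp add: power2_eq_square mult_left_le)
    ultimately have "exp (Re z) - exp (- Re z) \<le> 4 * Re z" using assms by linarith
    then show ?thesis unfolding sinh_field_def by simp
  qed
  have "(norm (sinh z))\<^sup>2 \<le> (2 * norm z)\<^sup>2"
  proof -
    have "(norm (sinh z))\<^sup>2 = (sinh (Re z))\<^sup>2 + (sin (Im z))\<^sup>2"
      by (rule norm_sinh_complex_power2)
    also have "\<dots> \<le> (2 * Re z)\<^sup>2 + (Im z)\<^sup>2"
    proof (rule add_mono)
      show "(sinh (Re z))\<^sup>2 \<le> (2 * Re z)\<^sup>2"
        using s assms by (intro power_mono) auto
      show "(sin (Im z))\<^sup>2 \<le> (Im z)\<^sup>2"
        using abs_sin_x_le_abs_x[of "Im z"] by (simp only: abs_le_square_iff)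
    qed
    also have "\<dots> \<le> (2 * norm z)\<^sup>2"
      by (simp add: cmod_power2 power_mult_distrib)
    finally show ?thesis .
  qed
  then have sz: "norm (sinh z) \<le> 2 * norm z"
    by (rule power2_le_imp_le) simp
  have "\<bar>cos (Im z)\<bar>\<^sup>2 \<le> (norm (cosh z))\<^sup>2"
    unfolding norm_cosh_complex_power2 by simp
  then have cz: "\<bar>cos (Im z)\<bar> \<le> norm (cosh z)"
    by (rule power2_le_imp_le) simp
  have "norm (tanh z / z) * \<bar>cos (Im z)\<bar> \<le> norm (tanh z / z) * norm (cosh z)"
    using cz by (intro mult_left_mono) auto
  also have "\<dots> = norm (sinh z) / norm z"
    using c by (simp add: tanh_def norm_divide norm_mult)
  also have "\<dots> \<le> 2" using sz z by (simp add: divide_le_eq)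
  finally show ?thesis .
qed

lemma norm_tanh_over_id_le_far:
  assumes "1 \<le> Re z"
  shows "norm (tanh z / z) \<le> 2 / Re z"
proof -
  have z: "z \<noteq> 0" using assms by auto
  have c: "cosh z \<noteq> 0" using cosh_complex_nonzero assms by auto
  have s1: "1 \<le> sinh (Re z)"
  proof -
    have "Re z \<le> sinh (Re z)" using real_le_x_sinh[of "Re z"] assms by (simp add: sinh_field_def exp_minus)
    then show ?thesis using assms by simp
  qed
  then have "1 \<le> (sinh (Re z))\<^sup>2" by (simp add: one_le_power)
  moreover have "(sin (Im z))\<^sup>2 \<le> 1" by (simp add: abs_square_le_1)
  moreover have "0 \<le> (cos (Im z))\<^sup>2" by simp
  ultimately have "(sin (Im z))\<^sup>2 \<le> 3 * (sinh (Re z))\<^sup>2 + 4 * (cos (Im z))\<^sup>2"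
    by linarith
  then have "(norm (sinh z))\<^sup>2 \<le> (2 * norm (cosh z))\<^sup>2"
    unfolding power_mult_distrib norm_cosh_complex_power2 norm_sinh_complex_power2
    by (simp add: algebra_simps)
  then have "norm (sinh z) \<le> 2 * norm (cosh z)"
    by (rule power2_le_imp_le) simp
  then have t: "norm (tanh z) \<le> 2" using c by (simp add: tanh_def norm_divide divide_le_eq)
  have "norm (tanh z / z) = norm (tanh z) / norm z" by (simp add: norm_divide)
  also have "\<dots> \<le> 2 / Re z"
    using t assms complex_Re_le_cmod[of z] by (intro frac_le) auto
  finally show ?thesis .
qed

lemma norm_tanh_over_id_le_horizontal:
  assumes "0 < Re z" "Im z = of_nat k * pi" "1 \<le> k"
  shows "norm (tanh z / z) \<le> 1"
proof -
  have c: "cosh z \<noteq> 0" using cosh_complex_nonzero assms by auto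
  have "sin (Im z) = 0" unfolding assms(2) by simp
  then have "(norm (sinh z))\<^sup>2 \<le> (norm (cosh z))\<^sup>2"
    unfolding norm_cosh_complex_power2 norm_sinh_complex_power2 by simp
  then have "norm (sinh z) \<le> norm (cosh z)"
    by (rule power2_le_imp_le) simp
  then have t: "norm (tanh z) \<le> 1" using c by (simp add: tanh_def norm_divide divide_le_eq)
  have "1 * 1 \<le> real k * pi" using assms(3) pi_gt3 by (intro mult_mono) auto
  then have "1 \<le> norm z" using abs_Im_le_cmod[of z] assms(2) by simp
  with t show ?thesis by (simp add: norm_divide divide_le_eq)
qed

section \<open>Integrability against the singularities of the square root of cos\<close>

lemma third_le_sin:
  assumes "0 \<le> u" "u \<le> pi / 2"
  shows "u / 3 \<le> sin u"
proof (cases "u \<le> pi / 3")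
  case True
  have "sin 0 - 0 / 3 \<le> sin u - u / 3"
  proof (rule DERIV_nonneg_imp_nondecreasing[OF assms(1)])
    fix x :: real assume x: "0 \<le> x" "x \<le> u"
    have "cos (pi / 3) \<le> cos x"
      using x True by (intro cos_monotone_0_pi_le) auto
    then have "0 \<le> cos x - 1 / 3" by (simp add: cos_60)
    moreover have "((\<lambda>x. sin x - x / 3) has_real_derivative cos x - 1 / 3) (at x)"
      by (auto intro!: derivative_eq_intros)
    ultimately show "\<exists>y. ((\<lambda>x. sin x - x / 3) has_real_derivative y) (at x) \<and> 0 \<le> y"
      by blast
  qed
  then show ?thesis by simp
next
  case False
  \<comment> \<open>The constant \<open>1/3\<close> is not optimal; with it the crude bound \<open>pi < 4\<close> suffices here.\<close>
  have "sin (pi / 3) \<le> sin u"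
    using False assms by (intro sin_monotone_2pi_le) auto
  moreover have "1.7 \<le> sqrt (3::real)" by (rule real_le_rsqrt) (simp add: power2_eq_square)
  ultimately show ?thesis using assms pi_less_4 by (simp add: sin_60)
qed

text \<open>
  Near each of its zeros the cosine behaves linearly, so the reciprocal of its square root has an
  integrable singularity with a constant that does not depend on the zero.
\<close>

lemma inverse_sqrt_cos_le:
  assumes "\<bar>u\<bar> \<le> pi / 2"
  shows "1 / sqrt \<bar>cos (real n * pi + pi / 2 + u)\<bar> \<le> sqrt 3 * \<bar>u\<bar> powr (- 1 / 2)"
proof (cases "u = 0")
  case True
  then show ?thesis by (simp add: cos_add)
next
  case False
  have "cos (real n * pi + pi / 2 + u) = - ((- 1) ^ n * sin u)"
    by (simp add: cos_add sin_add)
  then have "\<bar>cos (real n * pi + pi / 2 + u)\<bar> = \<bar>sin u\<bar>"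
    by (simp add: abs_mult)
  also have "\<dots> = sin \<bar>u\<bar>"
    using assms sin_ge_zero[of "\<bar>u\<bar>"] by (auto simp: abs_if split: if_splits)
  finally have eq: "\<bar>cos (real n * pi + pi / 2 + u)\<bar> = sin \<bar>u\<bar>" .
  have "\<bar>u\<bar> / 3 \<le> sin \<bar>u\<bar>" using assms by (intro third_le_sin) auto
  then have "1 / sqrt (sin \<bar>u\<bar>) \<le> 1 / sqrt (\<bar>u\<bar> / 3)"
    using False by (intro divide_left_mono) auto
  also have "\<dots> = sqrt 3 * \<bar>u\<bar> powr (- 1 / 2)"
    using False by (simp add: real_sqrt_divide powr_minus_divide powr_half_sqrt)
  finally show ?thesis unfolding eq .
qed

lemma nn_integral_inverse_sqrt_finite:
  "(\<integral>\<^sup>+u. ennreal (indicator {- pi / 2..pi / 2} u * (sqrt 3 * \<bar>u\<bar> powr (- 1 / 2))) \<partial>lborel) < \<infinity>"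
proof -
  define F :: "real \<Rightarrow> real" where "F = (\<lambda>u. indicator {0..pi / 2} u * u powr (- 1 / 2))"
  have [measurable]: "F \<in> borel_measurable borel" unfolding F_def by measurable
  have "((\<lambda>x. x powr (- 1 / 2)) has_integral ((pi/2) powr (- 1 / 2 + 1) / (- 1 / 2 + 1))) {0..pi/2}"
    by (rule has_integral_powr_from_0) auto
  then have "(\<integral>\<^sup>+u. ennreal (F u) \<partial>lborel) = ennreal ((pi/2) powr (- 1 / 2 + 1) / (- 1 / 2 + 1))"
    unfolding F_def by (intro nn_integral_has_integral_lebesgue) auto
  then have fin: "(\<integral>\<^sup>+u. ennreal (F u) \<partial>lborel) < \<infinity>" by simp
  have "(\<integral>\<^sup>+u. ennreal (F u) \<partial>lborel) = ennreal \<bar>-1\<bar> * (\<integral>\<^sup>+u. ennreal (F (0 + -1 * u)) \<partial>lborel)"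
    by (rule nn_integral_real_affine) auto
  then have fin': "(\<integral>\<^sup>+u. ennreal (F (- u)) \<partial>lborel) < \<infinity>" using fin by simp
  have "(\<integral>\<^sup>+u. ennreal (indicator {- pi / 2..pi / 2} u * (sqrt 3 * \<bar>u\<bar> powr (- 1 / 2))) \<partial>lborel)
      \<le> (\<integral>\<^sup>+u. ennreal (sqrt 3) * (ennreal (F u) + ennreal (F (- u))) \<partial>lborel)"
    by (intro nn_integral_mono)
       (auto simp: F_def indicator_def simp flip: ennreal_plus ennreal_mult)
  also have "\<dots> = ennreal (sqrt 3) * ((\<integral>\<^sup>+u. ennreal (F u) \<partial>lborel) + (\<integral>\<^sup>+u. ennreal (F (- u)) \<partial>lborel))"
    by (subst nn_integral_cmult, simp, subst nn_integral_add) auto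
  also have "\<dots> < \<infinity>" using fin fin' by (simp add: ennreal_mult_less_top)
  finally show ?thesis .
qed

text \<open>
  Every window \<open>[n pi, (n + 1) pi)\<close> contributes at most \<open>g (n pi)\<close> times the same finite
  constant. Both majorants needed below have this form: \<open>exp (- x y)\<close> for passing to the
  imaginary axis and a power \<open>s powr (- 3 / 2)\<close> for the integrability of the kernel.
\<close>

lemma integrable_decreasing_over_sqrt_cos:
  fixes g :: "real \<Rightarrow> real"
  assumes [measurable]: "g \<in> borel_measurable borel"
    and nonneg: "\<And>y. 0 \<le> y \<Longrightarrow> 0 \<le> g y"
    and decr: "\<And>x y. 0 \<le> x \<Longrightarrow> x \<le> y \<Longrightarrow> g y \<le> g x"
    and summ: "summable (\<lambda>n. g (real n * pi))"
  shows "integrable lborel (\<lambda>y. indicator {0..} y * (g y / sqrt \<bar>cos y\<bar>))"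
proof (rule integrableI_nonneg)
  define W where "W = (\<lambda>n. {real n * pi ..< real n * pi + pi})"
  define C where "C = (\<integral>\<^sup>+u. ennreal (indicator {- pi / 2..pi / 2} u * (sqrt 3 * \<bar>u\<bar> powr (- 1 / 2))) \<partial>lborel)"
  have win: "(\<integral>\<^sup>+y. ennreal (indicator (W n) y / sqrt \<bar>cos y\<bar>) \<partial>lborel) \<le> C" for n
  proof -
    define t where "t = real n * pi + pi / 2"
    have "(\<integral>\<^sup>+y. ennreal (indicator (W n) y / sqrt \<bar>cos y\<bar>) \<partial>lborel) =
      ennreal \<bar>1\<bar> * (\<integral>\<^sup>+u. ennreal (indicator (W n) (t + 1 * u) / sqrt \<bar>cos (t + 1 * u)\<bar>) \<partial>lborel)"
      by (rule nn_integral_real_affine) (auto simp: W_def)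
    also have "\<dots> \<le> C"
      unfolding C_def
    proof (simp, intro nn_integral_mono ennreal_leI)
      fix u :: real
      show "indicator (W n) (t + u) / sqrt \<bar>cos (t + u)\<bar>
         \<le> indicator {- (pi / 2)..pi / 2} u * (sqrt 3 * \<bar>u\<bar> powr - (1 / 2))"
      proof (cases "t + u \<in> W n")
        case True
        then have "\<bar>u\<bar> \<le> pi / 2" by (auto simp: W_def t_def)
        with True inverse_sqrt_cos_le[of u n] show ?thesis by (auto simp: t_def indicator_def)
      qed auto
    qed
    finally show ?thesis .
  qed
  have "(\<integral>\<^sup>+y. ennreal (indicator {0..} y * (g y / sqrt \<bar>cos y\<bar>)) \<partial>lborel)
     \<le> (\<integral>\<^sup>+y. (\<Sum>n. ennreal (g (real n * pi)) * ennreal (indicator (W n) y / sqrt \<bar>cos y\<bar>)) \<partial>lborel)"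
  proof (rule nn_integral_mono)
    fix y :: real
    show "ennreal (indicator {0..} y * (g y / sqrt \<bar>cos y\<bar>))
       \<le> (\<Sum>n. ennreal (g (real n * pi)) * ennreal (indicator (W n) y / sqrt \<bar>cos y\<bar>))"
    proof (cases "0 \<le> y")
      case True
      define n where "n = nat \<lfloor>y / pi\<rfloor>"
      have n: "real n \<le> y / pi" "y / pi < real n + 1"
        using True by (auto simp: n_def)
      then have y: "y \<in> W n" "real n * pi \<le> y"
        by (auto simp: W_def field_simps)
      let ?f = "\<lambda>n. ennreal (g (real n * pi)) * ennreal (indicator (W n) y / sqrt \<bar>cos y\<bar>)"
      have "ennreal (indicator {0..} y * (g y / sqrt \<bar>cos y\<bar>)) = ennreal (g y * (1 / sqrt \<bar>cos y\<bar>))"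
        using True by simp
      also have "\<dots> = ennreal (g y) * ennreal (1 / sqrt \<bar>cos y\<bar>)"
        using True nonneg by (intro ennreal_mult) auto
      also have "\<dots> \<le> ennreal (g (real n * pi)) * ennreal (1 / sqrt \<bar>cos y\<bar>)"
        using y decr[of "real n * pi" y] by (intro mult_right_mono ennreal_leI) auto
      also have "\<dots> = (\<Sum>k\<in>{n}. ?f k)" using y by simp
      also have "\<dots> \<le> (\<Sum>k. ?f k)" by (rule sum_le_suminf) auto
      finally show ?thesis .
    qed auto
  qed
  also have "\<dots> = (\<Sum>n. \<integral>\<^sup>+y. ennreal (g (real n * pi)) * ennreal (indicator (W n) y / sqrt \<bar>cos y\<bar>) \<partial>lborel)"
    by (rule nn_integral_suminf) (auto simp: W_def)
  also have "\<dots> = (\<Sum>n. ennreal (g (real n * pi)) * (\<integral>\<^sup>+y. ennreal (indicator (W n) y / sqrt \<bar>cos y\<bar>) \<partial>lborel))"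
    by (subst nn_integral_cmult) (auto simp: W_def)
  also have "\<dots> \<le> (\<Sum>n. ennreal (g (real n * pi)) * C)"
    by (intro suminf_le mult_left_mono win) auto
  also have "\<dots> = (\<Sum>n. ennreal (g (real n * pi))) * C"
    by simp
  also have "(\<Sum>n. ennreal (g (real n * pi))) = ennreal (\<Sum>n. g (real n * pi))"
    using summ nonneg by (intro suminf_ennreal2) auto
  also have "\<dots> * C < \<infinity>"
    using nn_integral_inverse_sqrt_finite unfolding C_def by (simp add: ennreal_mult_less_top)
  finally show "(\<integral>\<^sup>+y. ennreal (indicator {0..} y * (g y / sqrt \<bar>cos y\<bar>)) \<partial>lborel) < \<infinity>" .
  show "AE y in lborel. 0 \<le> indicator {0..} y * (g y / sqrt \<bar>cos y\<bar>)"
    using nonneg by (auto simp: indicator_def)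
qed measurable

section \<open>Rotating the Fourier integral onto the imaginary axis\<close>

definition whitham_integrand :: "real \<Rightarrow> complex \<Rightarrow> complex" where
  "whitham_integrand x z = csqrt (tanh z / z) * exp (\<i> * of_real x * z)"

text \<open>
  For \<open>y > 0\<close> with \<open>cos y \<noteq> 0\<close>, the limit of \<open>csqrt (tanh z / z)\<close> as \<open>z\<close> tends to \<open>\<i> y\<close>
  from the right. Since
  \<open>tanh z / z\<close> arrives from the lower half-plane, the root of a negative limit is
  \<open>- \<i> sqrt \<bar>tan y / y\<bar>\<close>; the principal root on the slit itself has the opposite sign.
\<close>

definition whitham_boundary_value :: "real \<Rightarrow> complex" where
  "whitham_boundary_value y =
     (if 0 \<le> tan y / y then of_real (sqrt (tan y / y)) else - \<i> * of_real (sqrt (- (tan y / y))))"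

lemma holomorphic_whitham_integrand: "whitham_integrand x holomorphic_on {z. 0 < Re z}"
proof -
  have "(\<lambda>z. ((exp z - exp (- z)) / 2) / ((exp z + exp (- z)) / 2) / z) holomorphic_on {z. 0 < Re z}"
    using cosh_complex_nonzero by (intro holomorphic_intros) (auto simp: cosh_field_def)
  then have "(\<lambda>z. tanh z / z) holomorphic_on {z. 0 < Re z}"
    by (simp add: tanh_def sinh_field_def cosh_field_def)
  then have "(\<lambda>z. csqrt (tanh z / z)) holomorphic_on {z. 0 < Re z}"
    by (rule holomorphic_on_csqrt') (auto simp: tanh_over_id_off_slit)
  then show ?thesis
    unfolding whitham_integrand_def
    by (rule holomorphic_on_mult) (simp add: holomorphic_on_exp')
qed

lemma integral_rectangle_right_halfplane:
  fixes f :: "complex \<Rightarrow> complex"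
  assumes hol: "f holomorphic_on {z. 0 < Re z}" and a: "0 < a" and ab: "a \<le> b" and h: "0 \<le> h"
  shows "integral {a..b} (\<lambda>t. f (of_real t)) =
      integral {0..h} (\<lambda>y. \<i> * f (Complex a y)) + integral {a..b} (\<lambda>t. f (Complex t h))
    - integral {0..h} (\<lambda>y. \<i> * f (Complex b y))"
proof -
  \<comment> \<open>Both sides are differences of one primitive at the four corners.\<close>
  obtain G where G: "\<And>z. z \<in> {z. 0 < Re z} \<Longrightarrow> (G has_field_derivative f z) (at z within {z. 0 < Re z})"
    using holomorphic_convex_primitive'[OF convex_halfspace_Re_gt open_halfspace_Re_gt hol] by blast
  have G': "(G has_field_derivative f z) (at z)" if "0 < Re z" for z
    using G[of z] that at_within_open[OF _ open_halfspace_Re_gt] by auto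
  have hor: "((\<lambda>t. f (Complex t y)) has_integral G (Complex b y) - G (Complex a y)) {a..b}" for y
  proof (rule fundamental_theorem_of_calculus[OF ab])
    fix t assume t: "t \<in> {a..b}"
    have "((\<lambda>t. of_real t + \<i> * of_real y) has_vector_derivative 1) (at t within {a..b})"
      by (auto intro!: derivative_eq_intros)
    then have "((G \<circ> (\<lambda>t. of_real t + \<i> * of_real y)) has_vector_derivative 1 * f (of_real t + \<i> * of_real y)) (at t within {a..b})"
      using t a by (intro field_vector_diff_chain_within has_field_derivative_at_within[OF G']) auto
    then show "((\<lambda>t. G (Complex t y)) has_vector_derivative f (Complex t y)) (at t within {a..b})"
      by (simp add: o_def Complex_eq)
  qed
  have vert: "((\<lambda>y. \<i> * f (Complex c y)) has_integral G (Complex c h) - G (Complex c 0)) {0..h}" if c: "0 < c" for c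
  proof (rule fundamental_theorem_of_calculus[OF h])
    fix t assume t: "t \<in> {0..h}"
    have "((\<lambda>t. of_real c + \<i> * of_real t) has_vector_derivative \<i>) (at t within {0..h})"
      by (auto intro!: derivative_eq_intros)
    then have "((G \<circ> (\<lambda>t. of_real c + \<i> * of_real t)) has_vector_derivative \<i> * f (of_real c + \<i> * of_real t)) (at t within {0..h})"
      using c by (intro field_vector_diff_chain_within has_field_derivative_at_within[OF G']) auto
    then show "((\<lambda>y. G (Complex c y)) has_vector_derivative \<i> * f (Complex c t)) (at t within {0..h})"
      by (simp add: o_def Complex_eq)
  qed
  have "0 < b" using a ab by simp
  then show ?thesis
    using hor[of 0, THEN integral_unique] hor[of h, THEN integral_unique]
      vert[OF a, THEN integral_unique] vert[of b, THEN integral_unique]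
    by (simp add: complex_of_real_def)
qed

lemma norm_whitham_integrand:
  "norm (whitham_integrand x z) = sqrt (norm (tanh z / z)) * exp (- (x * Im z))"
  by (simp add: whitham_integrand_def norm_mult)

lemma tanh_imaginary_axis: "tanh (Complex 0 y) = \<i> * of_real (tan y)"
  by (simp add: tan_def tanh_def complex_eq_iff Re_sinh_complex Im_sinh_complex
      Re_cosh_complex Im_cosh_complex Re_divide Im_divide power2_eq_square)

lemma tendsto_csqrt_tanh_over_id:
  assumes y: "0 < y" and c: "cos y \<noteq> 0" and e: "e \<longlonglongrightarrow> 0" and pos: "\<And>n. 0 < e n"
  shows "(\<lambda>n. csqrt (tanh (Complex (e n) y) / Complex (e n) y)) \<longlonglongrightarrow> whitham_boundary_value y"
proof -
  define q where "q = (\<lambda>n. tanh (Complex (e n) y) / Complex (e n) y)"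
  define w where "w = tan y / y"
  have z: "(\<lambda>n. Complex (e n) y) \<longlonglongrightarrow> Complex 0 y"
    by (intro tendsto_Complex e tendsto_const)
  have nz: "cosh (Complex 0 y) \<noteq> 0"
    using c by (simp add: complex_eq_iff Re_cosh_complex Im_cosh_complex)
  have "q \<longlonglongrightarrow> tanh (Complex 0 y) / Complex 0 y"
    unfolding q_def
    by (intro tendsto_divide z isCont_tendsto_compose[OF isCont_tanh[OF nz]]) (use y in \<open>auto simp: complex_eq_iff\<close>)
  also have "tanh (Complex 0 y) / Complex 0 y = of_real w"
  proof -
    have "Complex 0 y = \<i> * of_real y" by (simp add: complex_eq_iff)
    then show ?thesis unfolding tanh_imaginary_axis w_def using y by simp
  qed
  finally have q: "q \<longlonglongrightarrow> of_real w" .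
  have im: "Im (q n) < 0" for n
    unfolding q_def using Im_tanh_over_id_neg[of "Complex (e n) y"] pos y by simp
  consider "w = 0" | "w > 0" | "w < 0" by linarith
  then have "(\<lambda>n. csqrt (q n)) \<longlonglongrightarrow> whitham_boundary_value y"
  proof cases
    case 1
    have "(\<lambda>n. sqrt (norm (q n))) \<longlonglongrightarrow> sqrt (norm (0::complex))"
      using q 1 by (intro tendsto_intros) auto
    then have "(\<lambda>n. norm (csqrt (q n))) \<longlonglongrightarrow> 0" by simp
    then have "(\<lambda>n. csqrt (q n)) \<longlonglongrightarrow> 0" by (rule tendsto_norm_zero_cancel)
    moreover have "whitham_boundary_value y = 0"
    proof -
      have "tan y = 0" using 1 y by (simp add: w_def)
      then show ?thesis by (simp add: whitham_boundary_value_def)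
    qed
    ultimately show ?thesis by simp
  next
    case 2
    have "isCont csqrt (of_real w)"
      using 2 by (intro continuous_at_csqrt) (auto simp: complex_nonpos_Reals_iff)
    then have "(\<lambda>n. csqrt (q n)) \<longlonglongrightarrow> csqrt (of_real w)"
      using q by (rule isCont_tendsto_compose)
    moreover have "csqrt (of_real w) = of_real (sqrt w)"
      using 2 by (intro csqrt_of_real) auto
    moreover have "whitham_boundary_value y = of_real (sqrt w)"
      using 2 by (simp add: whitham_boundary_value_def flip: w_def)
    ultimately show ?thesis by simp
  next
    case 3
    \<comment> \<open>The root is discontinuous at \<open>w < 0\<close>; on the lower half-plane it equals \<open>- \<i> csqrt (- q)\<close>,
      which extends continuously.\<close>
    have "isCont csqrt (of_real (- w))"
      using 3 by (intro continuous_at_csqrt) (auto simp: complex_nonpos_Reals_iff)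
    then have "(\<lambda>n. csqrt (- q n)) \<longlonglongrightarrow> csqrt (of_real (- w))"
      by (rule isCont_tendsto_compose) (use tendsto_minus[OF q] in simp)
    then have "(\<lambda>n. - \<i> * csqrt (- q n)) \<longlonglongrightarrow> - \<i> * csqrt (of_real (- w))"
      by (intro tendsto_intros)
    moreover have "- \<i> * csqrt (- q n) = csqrt (q n)" for n
      using csqrt_minus[of "q n"] im[of n] by simp
    moreover have "csqrt (of_real (- w)) = of_real (sqrt (- w))"
      using 3 by (intro csqrt_of_real) auto
    moreover have "whitham_boundary_value y = - \<i> * of_real (sqrt (- w))"
      using 3 by (simp add: whitham_boundary_value_def flip: w_def)
    ultimately show ?thesis by simp
  qed
  then show ?thesis unfolding q_def .
qed

lemma AE_cos_nonzero: "AE y in lborel. cos (y::real) \<noteq> 0"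
proof -
  have "countable {y::real. cos y = 0}"
  proof (rule countable_subset)
    show "{y::real. cos y = 0} \<subseteq> range (\<lambda>i::int. of_int i * (pi / 2))"
      by (auto simp: cos_zero_iff_int)
  qed auto
  then have "{y::real. cos y = 0} \<in> null_sets lborel"
    by (rule countable_imp_null_set_lborel)
  then show ?thesis by (auto dest: AE_not_in)
qed

lemma summable_exp_multiples_pi:
  assumes "0 < x"
  shows "summable (\<lambda>n. exp (- (x * (real n * pi))))"
proof -
  have "exp (- (x * (real n * pi))) = exp (- (x * pi)) ^ n" for n
    by (simp add: exp_of_nat_mult[symmetric] algebra_simps)
  then show ?thesis using assms by (simp add: summable_geometric)
qed

lemma integrable_exp_over_sqrt_cos:
  assumes "0 < x"
  shows "integrable lborel (\<lambda>y. indicator {0..} y * (exp (- (x * y)) / sqrt \<bar>cos y\<bar>))"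
  by (rule integrable_decreasing_over_sqrt_cos[OF _ _ _ summable_exp_multiples_pi[OF assms]])
     (use assms in auto)

lemma whitham_integrand_of_real:
  "0 < t \<Longrightarrow> whitham_integrand x (of_real t) = of_real (whitham_symbol t) * exp (\<i> * of_real (x * t))"
proof -
  assume t: "0 < t"
  have "tanh (of_real t :: complex) = of_real (tanh t)"
    by (simp add: tanh_def sinh_field_def cosh_field_def flip: exp_of_real)
  then have "csqrt (tanh (of_real t) / of_real t) = csqrt (of_real (tanh t / t))"
    by simp
  also have "\<dots> = of_real (sqrt (tanh t / t))"
    using t by (intro csqrt_of_real) auto
  finally show ?thesis
    using t by (simp add: whitham_integrand_def whitham_symbol_def algebra_simps)
qed

lemma continuous_whitham_symbol: "continuous_on UNIV whitham_symbol"
proof -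
  have "isCont whitham_symbol t" for t
  proof (cases "t = 0")
    case True
    have "(tanh has_real_derivative 1) (at 0)"
      by (auto intro!: derivative_eq_intros)
    then have "(\<lambda>h. tanh h / h) \<midarrow>0\<rightarrow> (1::real)"
      by (simp add: DERIV_def)
    then have "(\<lambda>h. sqrt (tanh h / h)) \<midarrow>0\<rightarrow> sqrt 1"
      by (intro tendsto_intros)
    moreover have "\<forall>\<^sub>F h in at 0. sqrt (tanh h / h) = whitham_symbol h"
      by (auto simp: whitham_symbol_def eventually_at_filter)
    ultimately have "whitham_symbol \<midarrow>0\<rightarrow> sqrt 1"
      by (rule Lim_transform_eventually)
    then show ?thesis using True by (simp add: isCont_def whitham_symbol_def)
  next
    case False
    have "\<forall>\<^sub>F s in nhds t. whitham_symbol s = sqrt (tanh s / s)"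
      using t1_space_nhds[OF False] by eventually_elim (auto simp: whitham_symbol_def)
    then have "isCont whitham_symbol t \<longleftrightarrow> isCont (\<lambda>t. sqrt (tanh t / t)) t"
      by (rule isCont_cong)
    also have "isCont (\<lambda>t. sqrt (tanh t / t)) t"
      using False by (intro continuous_intros) auto
    finally show ?thesis by simp
  qed
  then show ?thesis by (simp add: continuous_on_eq_continuous_at)
qed

definition whitham_half_integral :: "real \<Rightarrow> complex" where
  "whitham_half_integral x =
     (LINT y|lborel. indicator {0..} y *\<^sub>R (\<i> * (whitham_boundary_value y * of_real (exp (- (x * y))))))"

lemma continuous_on_whitham_integrand:
  assumes "continuous_on S g" "\<And>t. t \<in> S \<Longrightarrow> 0 < Re (g t)"
  shows "continuous_on S (\<lambda>t. whitham_integrand x (g t))"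
  by (rule continuous_on_compose2[OF holomorphic_on_imp_continuous_on[OF holomorphic_whitham_integrand] assms(1)])
     (use assms(2) in auto)

lemma whitham_boundary_value_measurable [measurable]: "whitham_boundary_value \<in> borel_measurable borel"
  unfolding whitham_boundary_value_def tan_def by measurable

text \<open>
  Dominated convergence lets the edge move to the imaginary axis and grow to infinite height at
  the same time, along heights that suit \<open>top_edge_bound\<close>.
\<close>

lemma left_edge_tendsto:
  assumes x: "0 < x"
  shows "(\<lambda>n. integral {0..real (Suc n) * pi} (\<lambda>y. \<i> * whitham_integrand x (Complex (1 / real (Suc n)) y)))
     \<longlonglongrightarrow> whitham_half_integral x"
proof -
  define e where "e = (\<lambda>n. 1 / real (Suc n))"
  define s where "s = (\<lambda>n y. indicator {0..real (Suc n) * pi} y *\<^sub>R (\<i> * whitham_integrand x (Complex (e n) y)))"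
  have e: "e \<longlonglongrightarrow> 0" "\<And>n. 0 < e n" "\<And>n. e n \<le> 1"
    using LIMSEQ_inverse_real_of_nat by (auto simp: e_def inverse_eq_divide)
  have cont: "continuous_on A (\<lambda>y. \<i> * whitham_integrand x (Complex (e n) y))" for n A
    using e(2) by (intro continuous_intros continuous_on_whitham_integrand continuous_on_Complex) auto
  have eq: "integral {0..real (Suc n) * pi} (\<lambda>y. \<i> * whitham_integrand x (Complex (e n) y)) = (LINT y|lborel. s n y)" for n
    unfolding s_def
    using set_borel_integral_eq_integral(2)[OF borel_integrable_atLeastAtMost'[OF cont], of 0 "real (Suc n) * pi" n]
    by (simp only: set_lebesgue_integral_def)
  have lim: "whitham_half_integral x = (LINT y|lborel. indicator {0..} y *\<^sub>R (\<i> * (whitham_boundary_value y * of_real (exp (- (x * y))))))"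
    by (simp add: whitham_half_integral_def)
  have "(\<lambda>n. LINT y|lborel. s n y) \<longlonglongrightarrow> whitham_half_integral x"
    unfolding lim
  proof (rule integral_dominated_convergence)
    show "integrable lborel (\<lambda>y. sqrt 2 * (indicator {0..} y * (exp (- (x * y)) / sqrt \<bar>cos y\<bar>)))"
      by (intro integrable_mult_right integrable_exp_over_sqrt_cos x)
    show "s n \<in> borel_measurable lborel" for n
      unfolding s_def by (simp, intro borel_measurable_continuous_on_indicator cont) auto
    show "(\<lambda>y. indicator {0..} y *\<^sub>R (\<i> * (whitham_boundary_value y * of_real (exp (- (x * y)))))) \<in> borel_measurable lborel"
      by measurable
    show "AE y in lborel. norm (s n y) \<le> sqrt 2 * (indicator {0..} y * (exp (- (x * y)) / sqrt \<bar>cos y\<bar>))" for n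
      using AE_cos_nonzero
    proof eventually_elim
      case (elim y)
      show ?case
      proof (cases "y \<in> {0..real (Suc n) * pi}")
        case True
        have "norm (tanh (Complex (e n) y) / Complex (e n) y) * \<bar>cos y\<bar> \<le> 2"
          using norm_tanh_over_id_le_near_axis[of "Complex (e n) y"] e by simp
        then have "sqrt (norm (tanh (Complex (e n) y) / Complex (e n) y)) \<le> sqrt (2 / \<bar>cos y\<bar>)"
          using elim by (intro real_sqrt_le_mono) (simp add: pos_le_divide_eq)
        then have "norm (whitham_integrand x (Complex (e n) y)) \<le> sqrt (2 / \<bar>cos y\<bar>) * exp (- (x * y))"
          unfolding norm_whitham_integrand by (intro mult_mono) auto
        then show ?thesis using True by (simp add: s_def norm_mult real_sqrt_divide)
      next
        case False
        then have "norm (s n y) = 0" by (simp add: s_def)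
        also have "0 \<le> sqrt 2 * (indicator {0..} y * (exp (- (x * y)) / sqrt \<bar>cos y\<bar>))" by simp
        finally show ?thesis .
      qed
    qed
    show "AE y in lborel. (\<lambda>n. s n y) \<longlonglongrightarrow> indicator {0..} y *\<^sub>R (\<i> * (whitham_boundary_value y * of_real (exp (- (x * y)))))"
      using AE_cos_nonzero AE_lborel_singleton[of 0]
    proof eventually_elim
      case (elim y)
      show ?case
      proof (cases "0 < y")
        case True
        have "\<forall>\<^sub>F n in sequentially. y \<le> real n * pi"
          using eventually_ge_at_top[of "nat \<lceil>y / pi\<rceil>"]
        proof eventually_elim
          case (elim n)
          then have "y / pi \<le> real n" by linarith
          then show ?case by (simp add: field_simps)
        qed
        then have ev: "\<forall>\<^sub>F n in sequentially. \<i> * whitham_integrand x (Complex (e n) y) = s n y"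
        proof eventually_elim
          case (elim n)
          have "real n * pi \<le> real (Suc n) * pi" by simp
          then have "y \<in> {0..real (Suc n) * pi}" using elim True pi_gt_zero
            by (auto simp: distrib_right intro: add_increasing)
          then show ?case by (simp only: s_def indicator_simps scaleR_one)
        qed
        have "(\<lambda>n. whitham_integrand x (Complex (e n) y)) \<longlonglongrightarrow>
            whitham_boundary_value y * exp (\<i> * of_real x * Complex 0 y)"
          unfolding whitham_integrand_def
          by (intro tendsto_intros tendsto_csqrt_tanh_over_id[OF True elim(1) e(1,2)] tendsto_Complex e(1))
        moreover have "exp (\<i> * of_real x * Complex 0 y) = of_real (exp (- (x * y)))"
          by (simp add: Complex_eq exp_of_real[symmetric] algebra_simps del: exp_of_real)
        ultimately have "(\<lambda>n. \<i> * whitham_integrand x (Complex (e n) y)) \<longlonglongrightarrow>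
            \<i> * (whitham_boundary_value y * of_real (exp (- (x * y))))"
          by (intro tendsto_intros) simp
        then have "(\<lambda>n. s n y) \<longlonglongrightarrow> \<i> * (whitham_boundary_value y * of_real (exp (- (x * y))))"
          using ev by (rule Lim_transform_eventually)
        then show ?thesis using True by simp
      next
        case False
        then show ?thesis using elim by (simp add: s_def)
      qed
    qed
  qed
  then show ?thesis using eq by (simp add: e_def)
qed

lemma right_edge_bound:
  assumes x: "0 < x" and R: "1 \<le> R" and h: "0 \<le> h"
  shows "norm (integral {0..h} (\<lambda>y. \<i> * whitham_integrand x (Complex R y))) \<le> sqrt (2 / R) / x"
proof -
  have I: "((\<lambda>y. sqrt (2 / R) * exp (- (x * y))) has_integral
      (- sqrt (2 / R) / x * exp (- (x * h)) - (- sqrt (2 / R) / x * exp (- (x * 0))))) {0..h}"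
    using x by (intro fundamental_theorem_of_calculus h)
      (auto intro!: derivative_eq_intros simp flip: has_real_derivative_iff_has_vector_derivative)
  have "norm (integral {0..h} (\<lambda>y. \<i> * whitham_integrand x (Complex R y))) \<le>
      integral {0..h} (\<lambda>y. sqrt (2 / R) * exp (- (x * y)))"
  proof (rule Henstock_Kurzweil_Integration.integral_norm_bound_integral)
    show "(\<lambda>y. \<i> * whitham_integrand x (Complex R y)) integrable_on {0..h}"
      using R by (intro integrable_continuous_interval continuous_intros continuous_on_whitham_integrand continuous_on_Complex) auto
    show "(\<lambda>y. sqrt (2 / R) * exp (- (x * y))) integrable_on {0..h}" using I by blast
    fix y
    have "norm (tanh (Complex R y) / Complex R y) \<le> 2 / R"
      using norm_tanh_over_id_le_far[of "Complex R y"] R by simp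
    then show "norm (\<i> * whitham_integrand x (Complex R y)) \<le> sqrt (2 / R) * exp (- (x * y))"
      unfolding norm_mult norm_whitham_integrand by (simp add: mult_right_mono)
  qed
  also have "\<dots> = sqrt (2 / R) / x * (1 - exp (- (x * h)))"
    by (subst integral_unique[OF I]) (simp add: right_diff_distrib)
  also have "\<dots> \<le> sqrt (2 / R) / x * 1"
    using x R by (intro mult_left_mono) auto
  finally show ?thesis by simp
qed

lemma top_edge_bound:
  assumes R: "0 < a" "a \<le> R" and k: "1 \<le> k"
  shows "norm (integral {a..R} (\<lambda>t. whitham_integrand x (Complex t (real k * pi)))) \<le> R * exp (- (x * (real k * pi)))"
proof -
  have "norm (integral {a..R} (\<lambda>t. whitham_integrand x (Complex t (real k * pi)))) \<le> exp (- (x * (real k * pi))) * (R - a)"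
  proof (rule integral_bound[OF R(2)])
    show "continuous_on {a..R} (\<lambda>t. whitham_integrand x (Complex t (real k * pi)))"
      using R by (intro continuous_on_whitham_integrand continuous_on_Complex continuous_intros) auto
    fix t assume t: "t \<in> {a..R}"
    have "norm (tanh (Complex t (real k * pi)) / Complex t (real k * pi)) \<le> 1"
      using norm_tanh_over_id_le_horizontal[of "Complex t (real k * pi)" k] t R k by simp
    then show "norm (whitham_integrand x (Complex t (real k * pi))) \<le> exp (- (x * (real k * pi)))"
      unfolding norm_whitham_integrand using mult_right_mono[of "sqrt _" 1] by simp
  qed
  also have "\<dots> \<le> exp (- (x * (real k * pi))) * R" using R by (intro mult_left_mono) auto
  finally show ?thesis by (simp add: mult.commute)
qed

text \<open>
  Cauchy's theorem on the rectangles with corners \<open>1 / (n + 1)\<close> and \<open>R + \<i> (n + 1) pi\<close>, for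
  fixed \<open>R\<close> and \<open>n\<close> tending to infinity: the bottom edge becomes the truncated Fourier integral,
  the left edge the Laplace integral, the top edge vanishes, and the right edge is the error. The
  error tends to \<open>0\<close> with \<open>R\<close>, which gives conditional convergence of the Fourier integral.
\<close>

lemma whitham_partial_integral_error:
  assumes x: "0 < x" and R: "1 \<le> R"
  shows "norm (integral {0..R} (\<lambda>t. of_real (whitham_symbol t) * exp (\<i> * of_real (x * t))) - whitham_half_integral x)
     \<le> sqrt (2 / R) / x"
proof -
  define m where "m = (\<lambda>t. of_real (whitham_symbol t) * exp (\<i> * of_real (x * t)))"
  define e where "e = (\<lambda>n. 1 / real (Suc n))"
  define h where "h = (\<lambda>n. real (Suc n) * pi)"
  have e: "e \<longlonglongrightarrow> 0" "\<And>n. 0 < e n" "\<And>n. e n \<le> 1"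
    using LIMSEQ_inverse_real_of_nat by (auto simp: e_def inverse_eq_divide)
  have h: "0 \<le> h n" for n by (simp add: h_def)
  have int: "m integrable_on {0..R}"
    unfolding m_def
    by (intro integrable_continuous_interval continuous_intros continuous_on_subset[OF continuous_whitham_symbol]) auto
  define B where "B = (\<lambda>n. integral {e n..R} m)"
  define L where "L = (\<lambda>n. integral {0..h n} (\<lambda>y. \<i> * whitham_integrand x (Complex (e n) y)))"
  define T where "T = (\<lambda>n. integral {e n..R} (\<lambda>t. whitham_integrand x (Complex t (h n))))"
  define S where "S = (\<lambda>n. integral {0..h n} (\<lambda>y. \<i> * whitham_integrand x (Complex R y)))"
  have contB: "continuous_on {0..R} (\<lambda>a. integral {a..R} m)"
    by (rule indefinite_integral_continuous_1'[OF int])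
  have eR: "e n \<in> {0..R}" for n
    using e(2)[of n] e(3)[of n] R by simp
  have B: "B \<longlonglongrightarrow> integral {0..R} m"
    unfolding B_def
    by (rule continuous_on_tendsto_compose[OF contB e(1)]) (use R eR in auto)
  have L: "L \<longlonglongrightarrow> whitham_half_integral x"
    using left_edge_tendsto[OF x] by (simp add: L_def h_def e_def)
  have "(\<lambda>n. exp (- (x * (real n * pi)))) \<longlonglongrightarrow> 0"
    by (rule summable_LIMSEQ_zero[OF summable_exp_multiples_pi[OF x]])
  then have "(\<lambda>n. exp (- (x * h n))) \<longlonglongrightarrow> 0"
    unfolding h_def by (rule LIMSEQ_Suc)
  then have "(\<lambda>n. R * exp (- (x * h n))) \<longlonglongrightarrow> 0" by (rule tendsto_mult_right_zero)
  moreover have "norm (T n) \<le> R * exp (- (x * h n))" for n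
    unfolding T_def h_def using R e(2)[of n] e(3)[of n] by (intro top_edge_bound) auto
  ultimately have T: "T \<longlonglongrightarrow> 0"
    by (rule Lim_null_comparison[OF always_eventually[OF allI], rotated])
  have rect: "B n = L n + T n - S n" for n
  proof -
    have "B n = integral {e n..R} (\<lambda>t. whitham_integrand x (of_real t))"
      unfolding B_def
    proof (rule integral_cong)
      fix t assume "t \<in> {e n..R}"
      then have "0 < t" using e(2)[of n] by simp
      then show "m t = whitham_integrand x (of_real t)" by (simp add: m_def whitham_integrand_of_real)
    qed
    then show ?thesis
      using integral_rectangle_right_halfplane[OF holomorphic_whitham_integrand, of "e n" R "h n" x] e R h
      by (auto simp: L_def T_def S_def intro: order_trans)
  qed
  have "norm (B n - L n - T n) \<le> sqrt (2 / R) / x" for n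
    using right_edge_bound[OF x R h[of n]] rect[of n] by (simp add: S_def)
  moreover have "(\<lambda>n. norm (B n - L n - T n)) \<longlonglongrightarrow> norm (integral {0..R} m - whitham_half_integral x - 0)"
    by (intro tendsto_intros B L T)
  ultimately have "norm (integral {0..R} m - whitham_half_integral x - 0) \<le> sqrt (2 / R) / x"
    by (intro LIMSEQ_le_const2) auto
  then show ?thesis by (simp add: m_def)
qed

section \<open>The Whitham kernel as a Laplace transform\<close>

text \<open>
  The real part of \<open>\<i>\<close> times the boundary value, divided by \<open>pi\<close>: it lives on the intervals
  \<open>(n pi + pi/2, (n + 1) pi)\<close>, where \<open>tan s / s\<close> is negative.
\<close>

definition whitham_density :: "real \<Rightarrow> real" where
  "whitham_density s = indicator {0..} s * sqrt (max 0 (- (tan s / s))) / pi"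

lemma whitham_density_measurable [measurable]: "whitham_density \<in> borel_measurable borel"
  unfolding whitham_density_def tan_def by measurable

lemma whitham_density_nonneg: "0 \<le> whitham_density s"
  by (simp add: whitham_density_def)

lemma abs_tan_over_id_le:
  fixes y :: real
  assumes "0 \<le> y"
  shows "\<bar>tan y / y\<bar> \<le> 1 / \<bar>cos y\<bar>"
proof -
  have "\<bar>tan y / y\<bar> = \<bar>sin y\<bar> / \<bar>cos y\<bar> / \<bar>y\<bar>"
    by (simp only: tan_def abs_divide)
  also have "\<dots> = (\<bar>sin y\<bar> / y) / \<bar>cos y\<bar>"
    using assms by simp
  also have "\<dots> \<le> 1 / \<bar>cos y\<bar>"
    using abs_sin_x_le_abs_x[of y] assms by (intro divide_right_mono) (auto simp: divide_le_eq)
  finally show ?thesis .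
qed

lemma norm_whitham_boundary_value_le:
  assumes "0 \<le> y"
  shows "norm (whitham_boundary_value y) \<le> 1 / sqrt \<bar>cos y\<bar>"
proof -
  have "norm (whitham_boundary_value y) = sqrt \<bar>tan y / y\<bar>"
    by (cases "0 \<le> tan y / y") (simp_all add: whitham_boundary_value_def norm_mult abs_of_neg del: abs_divide)
  also have "\<dots> \<le> sqrt (1 / \<bar>cos y\<bar>)"
    by (intro real_sqrt_le_mono abs_tan_over_id_le assms)
  finally show ?thesis by (simp add: real_sqrt_divide)
qed

lemma integrable_whitham_half_integrand:
  assumes "0 < x"
  shows "integrable lborel (\<lambda>y. indicator {0..} y *\<^sub>R (\<i> * (whitham_boundary_value y * of_real (exp (- (x * y))))))"
proof (rule Bochner_Integration.integrable_bound[OF integrable_exp_over_sqrt_cos[OF assms]])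
  show "AE y in lborel. norm (indicator {0..} y *\<^sub>R (\<i> * (whitham_boundary_value y * of_real (exp (- (x * y)))))) \<le>
      norm (indicator {0..} y * (exp (- (x * y)) / sqrt \<bar>cos y\<bar>))"
  proof (rule AE_I2)
    fix y :: real
    show "norm (indicator {0..} y *\<^sub>R (\<i> * (whitham_boundary_value y * of_real (exp (- (x * y)))))) \<le>
      norm (indicator {0..} y * (exp (- (x * y)) / sqrt \<bar>cos y\<bar>))"
    proof (cases "0 \<le> y")
      case True
      then show ?thesis
        using mult_right_mono[OF norm_whitham_boundary_value_le[OF True], of "exp (- (x * y))"]
        by (simp add: norm_mult)
    qed simp
  qed
qed measurable

lemma Re_whitham_half_integral:
  assumes "0 < x"
  shows "Re (whitham_half_integral x) = pi * (LINT s|lborel. whitham_density s * exp (- (x * s)))"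
proof -
  have "Re (whitham_half_integral x) =
    (LINT y|lborel. Re (indicator {0..} y *\<^sub>R (\<i> * (whitham_boundary_value y * of_real (exp (- (x * y)))))))"
    unfolding whitham_half_integral_def
    by (rule integral_Re[symmetric]) (rule integrable_whitham_half_integrand[OF assms])
  also have "\<dots> = (LINT s|lborel. pi * (whitham_density s * exp (- (x * s))))"
  proof (rule Bochner_Integration.integral_cong[OF refl])
    fix y :: real
    show "Re (indicator {0..} y *\<^sub>R (\<i> * (whitham_boundary_value y * of_real (exp (- (x * y)))))) =
      pi * (whitham_density y * exp (- (x * y)))"
      by (cases "0 \<le> tan y / y") (simp_all add: whitham_boundary_value_def whitham_density_def max_def)
  qed
  finally show ?thesis by simp
qed

text \<open>
  A gauge integral over the line may be computed along arbitrary growing intervals \<open>[a, b]\<close>. The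
  two halves are treated separately: the symbol is even, so the negative half axis contributes the
  complex conjugate, and the imaginary parts cancel in the limit.
\<close>

lemma has_integral_whitham_fourier:
  assumes x: "0 < x"
  shows "((\<lambda>\<xi>. of_real (whitham_symbol \<xi>) * exp (\<i> * of_real (x * \<xi>))) has_integral
     of_real (2 * Re (whitham_half_integral x))) UNIV"
proof -
  define m where "m = (\<lambda>\<xi>. of_real (whitham_symbol \<xi>) * exp (\<i> * of_real (x * \<xi>)))"
  define A where "A = whitham_half_integral x"
  have int: "m integrable_on {a..b}" for a b
    unfolding m_def
    by (intro integrable_continuous_interval continuous_intros continuous_on_subset[OF continuous_whitham_symbol]) auto
  have refl: "m (- t) = cnj (m t)" for t
    by (simp add: m_def whitham_symbol_def exp_cnj)
  have err: "norm (integral {0..R} m - A) \<le> sqrt (2 / R) / x" if "1 \<le> R" for R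
    using whitham_partial_integral_error[OF x that] by (simp add: m_def A_def)
  have "(m has_integral (A + cnj A)) UNIV"
    unfolding has_integral_alt'
  proof (intro conjI allI impI)
    show "(\<lambda>t. if t \<in> UNIV then m t else 0) integrable_on cbox a b" for a b
      using int[of a b] by (simp add: cbox_interval)
    fix e :: real assume e: "0 < e"
    have "((\<lambda>R. 2 * (sqrt (2 / R) / x)) \<longlongrightarrow> 2 * (sqrt 0 / x)) at_top"
      by (intro tendsto_intros tendsto_divide_0[OF tendsto_const] filterlim_at_top_imp_at_infinity filterlim_ident) (use x in auto)
    then have "\<forall>\<^sub>F R in at_top. 2 * (sqrt (2 / R) / x) < e"
      using e by (intro order_tendstoD(2)) auto
    then obtain R where R: "2 * (sqrt (2 / R) / x) < e" "1 \<le> R"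
      using eventually_conj[OF _ eventually_ge_at_top[of 1]] by (metis (mono_tags, lifting) eventually_happens' trivial_limit_at_top_linorder)
    show "\<exists>B>0. \<forall>a b. ball 0 B \<subseteq> cbox a b \<longrightarrow>
        norm (integral (cbox a b) (\<lambda>t. if t \<in> UNIV then m t else 0) - (A + cnj A)) < e"
    proof (intro exI[of _ "2 * R"] conjI allI impI)
      fix a b assume sub: "ball (0::real) (2 * R) \<subseteq> cbox a b"
      have "R \<in> ball 0 (2 * R)" "- R \<in> ball 0 (2 * R)" using R by (auto simp: dist_norm)
      then have "R \<in> cbox a b" "- R \<in> cbox a b" using sub by blast+
      then have ab: "R \<le> b" "R \<le> - a" by (simp_all add: cbox_interval)
      have "integral {a..b} m = integral {a..0} m + integral {0..b} m"
        using Henstock_Kurzweil_Integration.integral_combine[of a 0 b m] int ab R by simp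
      also have "integral {a..0} m = integral {0..- a} (\<lambda>t. m (- t))"
        using Henstock_Kurzweil_Integration.integral_reflect_real[of 0 a m] by simp
      also have "\<dots> = cnj (integral {0..- a} m)"
        by (simp add: refl Henstock_Kurzweil_Integration.integral_cnj)
      finally have "integral {a..b} m - (A + cnj A) = cnj (integral {0..- a} m - A) + (integral {0..b} m - A)"
        by simp
      then have "norm (integral {a..b} m - (A + cnj A)) \<le> norm (integral {0..- a} m - A) + norm (integral {0..b} m - A)"
        by (metis norm_triangle_ineq complex_mod_cnj)
      also have "\<dots> \<le> sqrt (2 / - a) / x + sqrt (2 / b) / x"
        using ab R by (intro add_mono err) auto
      also have "\<dots> \<le> sqrt (2 / R) / x + sqrt (2 / R) / x"
        using ab R x by (intro add_mono divide_right_mono real_sqrt_le_mono frac_le) auto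
      finally show "norm (integral (cbox a b) (\<lambda>t. if t \<in> UNIV then m t else 0) - (A + cnj A)) < e"
        using R(1) by (simp add: cbox_interval)
    qed (use R in auto)
  qed
  then show ?thesis by (simp add: m_def A_def complex_add_cnj)
qed

lemma whitham_kernel_eq_laplace:
  assumes "x \<noteq> 0"
  shows "whitham_kernel x = (LINT s|lborel. whitham_density s * exp (- (s * \<bar>x\<bar>)))"
proof -
  have pos: "whitham_kernel x = (LINT s|lborel. whitham_density s * exp (- (s * x)))" if "0 < x" for x
  proof -
    have "integral UNIV (\<lambda>\<xi>. of_real (whitham_symbol \<xi>) * exp (\<i> * of_real (x * \<xi>)))
        = complex_of_real (2 * Re (whitham_half_integral x))"
      by (rule integral_unique[OF has_integral_whitham_fourier[OF that]])
    then show ?thesis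
      using Re_whitham_half_integral[OF that] by (simp add: whitham_kernel_def mult.commute)
  qed
  have even: "whitham_kernel (- x) = whitham_kernel x" for x
  proof -
    have "integral UNIV (\<lambda>\<xi>::real. of_real (whitham_symbol \<xi>) * exp (\<i> * of_real (- x * \<xi>)))
       = integral UNIV (\<lambda>\<xi>. cnj (of_real (whitham_symbol \<xi>) * exp (\<i> * of_real (x * \<xi>))))"
      by (simp add: exp_cnj)
    also have "\<dots> = cnj (integral UNIV (\<lambda>\<xi>. of_real (whitham_symbol \<xi>) * exp (\<i> * of_real (x * \<xi>))))"
      by (simp only: Henstock_Kurzweil_Integration.integral_cnj)
    finally show ?thesis by (simp add: whitham_kernel_def)
  qed
  show ?thesis using pos[of x] pos[of "- x"] even[of x] assms by (cases "0 < x") auto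
qed

lemma whitham_density_eq_0: "s < pi / 2 \<Longrightarrow> whitham_density s = 0"
proof (cases "0 \<le> s")
  case True
  moreover assume "s < pi / 2"
  ultimately have "0 \<le> tan s" using tan_gt_zero[of s] by (cases "s = 0") auto
  then have "0 \<le> tan s / s" using True by (rule divide_nonneg_nonneg)
  then have "max 0 (- (tan s / s)) = 0" by simp
  then show ?thesis by (simp add: whitham_density_def)
qed (simp add: whitham_density_def)

lemma whitham_density_pos:
  assumes "pi / 2 < s" "s < pi"
  shows "0 < whitham_density s"
proof -
  have s: "0 < s" using assms(1) pi_gt_zero by linarith
  have "0 < sin s" using assms s by (intro sin_gt_zero)
  moreover have "cos s < cos (pi / 2)" using assms by (intro cos_monotone_0_pi) auto
  ultimately have "tan s / s < 0" using s by (simp add: tan_def divide_pos_neg mult_neg_pos)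
  then show ?thesis using s by (simp add: whitham_density_def max_def)
qed

text \<open>
  By Tonelli this is the integrability of the kernel, since \<open>exp (- s \<bar>x\<bar>)\<close> has integral
  \<open>2 / s\<close>. Near \<open>s = 0\<close> the density vanishes, and at infinity it decays like \<open>s powr (- 1 / 2)\<close>
  away from the zeros of the cosine.
\<close>

lemma integrable_whitham_density_over_id: "integrable lborel (\<lambda>s. whitham_density s / s)"
proof -
  define g :: "real \<Rightarrow> real" where "g = (\<lambda>s. max 1 s powr (- 3 / 2))"
  have [measurable]: "g \<in> borel_measurable borel" unfolding g_def by measurable
  have "summable (\<lambda>n. g (real n * pi))"
  proof (rule summable_comparison_test)
    show "summable (\<lambda>n. real n powr (- 3 / 2))" by (simp add: summable_real_powr_iff)
    have "norm (g (real n * pi)) \<le> real n powr (- 3 / 2)" if "1 \<le> n" for n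
    proof -
      have "real n * 1 \<le> real n * pi" using pi_gt3 by (intro mult_left_mono) auto
      then have "1 \<le> real n * pi" using that by linarith
      then have "g (real n * pi) = (real n * pi) powr (- 3 / 2)" by (simp add: g_def)
      also have "\<dots> \<le> real n powr (- 3 / 2)"
        using \<open>real n * 1 \<le> real n * pi\<close> that by (intro powr_mono2') auto
      finally show ?thesis by (simp add: g_def)
    qed
    then show "\<exists>N. \<forall>n\<ge>N. norm (g (real n * pi)) \<le> real n powr (- 3 / 2)" by blast
  qed
  then have I: "integrable lborel (\<lambda>y. indicator {0..} y * (g y / sqrt \<bar>cos y\<bar>))"
    by (intro integrable_decreasing_over_sqrt_cos) (auto simp: g_def intro!: powr_mono2')
  show ?thesis
  proof (rule Bochner_Integration.integrable_bound[OF I])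
    show "AE s in lborel. norm (whitham_density s / s) \<le> norm (indicator {0..} s * (g s / sqrt \<bar>cos s\<bar>))"
    proof (rule AE_I2)
      fix s :: real
      show "norm (whitham_density s / s) \<le> norm (indicator {0..} s * (g s / sqrt \<bar>cos s\<bar>))"
      proof (cases "s < pi / 2")
        case True
        then show ?thesis by (simp add: whitham_density_eq_0)
      next
        case False
        then have s: "1 \<le> s" using pi_gt3 by simp
        have "max 0 (- (tan s / s)) \<le> \<bar>sin s\<bar> / (s * \<bar>cos s\<bar>)"
        proof -
          have "\<bar>tan s / s\<bar> = \<bar>sin s\<bar> / \<bar>cos s\<bar> / \<bar>s\<bar>"
            by (simp only: tan_def abs_divide)
          also have "\<dots> = \<bar>sin s\<bar> / (s * \<bar>cos s\<bar>)" using s by (simp add: mult.commute)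
          finally have eq: "\<bar>tan s / s\<bar> = \<bar>sin s\<bar> / (s * \<bar>cos s\<bar>)" .
          show ?thesis
            unfolding eq[symmetric] by (rule max.boundedI) (rule abs_ge_zero, rule abs_ge_minus_self)
        qed
        also have "\<dots> \<le> 1 / (s * \<bar>cos s\<bar>)" using s by (intro divide_right_mono) auto
        finally have "sqrt (max 0 (- (tan s / s))) \<le> sqrt (1 / (s * \<bar>cos s\<bar>))"
          by (rule real_sqrt_le_mono)
        then have "sqrt (max 0 (- (tan s / s))) / pi \<le> sqrt (1 / (s * \<bar>cos s\<bar>)) / 1"
          using pi_gt3 by (intro frac_le) auto
        then have "whitham_density s / s \<le> 1 / sqrt s / sqrt \<bar>cos s\<bar> / s"
          using s by (intro divide_right_mono) (simp_all add: whitham_density_def real_sqrt_divide real_sqrt_mult)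
        also have "\<dots> = g s / sqrt \<bar>cos s\<bar>"
        proof -
          have "s powr (3 / 2) = s powr (1 / 2 + 1)" by simp
          also have "\<dots> = sqrt s * s" using s by (simp only: powr_add) (simp add: powr_half_sqrt)
          finally show ?thesis using s by (simp add: g_def max_def powr_minus_divide)
        qed
        finally show ?thesis using s whitham_density_nonneg[of s] by (simp add: g_def)
      qed
    qed
  qed measurable
qed

lemma integral_pos_of_pos_on_interval:
  fixes h :: "real \<Rightarrow> real"
  assumes int: "integrable lborel h" and nonneg: "\<And>s. 0 \<le> h s"
    and ab: "a < b" and pos: "\<And>s. a < s \<Longrightarrow> s < b \<Longrightarrow> 0 < h s"
  shows "0 < (LINT s|lborel. h s)"
proof (rule ccontr)
  assume "\<not> 0 < (LINT s|lborel. h s)"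
  moreover have "0 \<le> (LINT s|lborel. h s)" using nonneg by simp
  ultimately have "(LINT s|lborel. h s) = 0" by simp
  then have "AE s in lborel. h s = 0"
    using integral_nonneg_eq_0_iff_AE[OF int] nonneg by simp
  then have "AE s in lborel. s \<notin> {a<..<b}"
    by eventually_elim (use pos in fastforce)
  then have "{a<..<b} \<in> null_sets lborel"
    by (subst (asm) AE_iff_null_sets[symmetric]) auto
  then show False using ab by (simp add: null_sets_def)
qed

section \<open>The Whitham operator as a superposition of resolvents\<close>

text \<open>
  Convolution with \<open>exp (- s \<bar>x\<bar>)\<close>; up to the factor \<open>2 * s\<close> this is the resolvent
  \<open>(s\<^sup>2 - d\<^sup>2/dx\<^sup>2)\<close> to the power \<open>-1\<close>.
\<close>

definition resolvent_op :: "real \<Rightarrow> (real \<Rightarrow> real) \<Rightarrow> real \<Rightarrow> real" where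
  "resolvent_op s f x = (LINT y|lborel. exp (- (s * \<bar>x - y\<bar>)) * f y)"

lemma has_bochner_integral_exp_half_line:
  assumes "0 < s"
  shows "has_bochner_integral lborel (\<lambda>y::real. indicator {0..} y * exp (- (s * y))) (1 / s)"
proof (rule has_bochner_integral_nn_integral)
  have "((\<lambda>y. exp (- s * y)) has_integral exp (- s * 0) / s) {0..}"
    by (rule has_integral_exp_minus_to_infinity[OF assms])
  then show "(\<integral>\<^sup>+y. ennreal (indicator {0..} y * exp (- (s * y))) \<partial>lborel) = ennreal (1 / s)"
    by (intro nn_integral_has_integral_lebesgue) auto
qed (use assms in auto)

lemma has_bochner_integral_exp_abs:
  fixes s x :: real
  assumes "0 < s"
  shows "has_bochner_integral lborel (\<lambda>y. exp (- (s * \<bar>x - y\<bar>))) (2 / s)"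
proof -
  define F :: "real \<Rightarrow> real" where "F = (\<lambda>y. indicator {0..} y * exp (- (s * y)))"
  have F: "has_bochner_integral lborel F (1 / s)"
    unfolding F_def by (rule has_bochner_integral_exp_half_line[OF assms])
  have "has_bochner_integral lborel (\<lambda>y. F (x + -1 * y)) ((1 / s) /\<^sub>R \<bar>-1\<bar>)"
    using F by (subst (asm) lborel_has_bochner_integral_real_affine_iff[of "-1" _ _ x]) auto
  moreover have "has_bochner_integral lborel (\<lambda>y. F (- x + 1 * y)) ((1 / s) /\<^sub>R \<bar>1\<bar>)"
    using F by (subst (asm) lborel_has_bochner_integral_real_affine_iff[of 1 _ _ "- x"]) auto
  ultimately have "has_bochner_integral lborel (\<lambda>y. F (x + -1 * y) + F (- x + 1 * y)) ((1 / s) /\<^sub>R \<bar>-1\<bar> + (1 / s) /\<^sub>R \<bar>1\<bar>)"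
    by (rule has_bochner_integral_add)
  then have "has_bochner_integral lborel (\<lambda>y. F (x - y) + F (y - x)) (2 / s)"
    by simp
  then show ?thesis
  proof (subst has_bochner_integral_cong_AE)
    show "AE y in lborel. exp (- (s * \<bar>x - y\<bar>)) = F (x - y) + F (y - x)"
      using AE_lborel_singleton[of x]
      by eventually_elim (auto simp: F_def indicator_def abs_if)
  qed (auto simp: F_def)
qed

lemma integrable_density_exp_product:
  "integrable (lborel \<Otimes>\<^sub>M lborel) (\<lambda>(s, y). whitham_density s * exp (- (s * \<bar>x - y\<bar>)))"
proof (rule lborel_pair.Fubini_integrable)
  have inner: "(LINT y|lborel. norm (whitham_density s * exp (- (s * \<bar>x - y\<bar>)))) = 2 * (whitham_density s / s)" for s
  proof (cases "0 < s")
    case True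
    then show ?thesis
      using has_bochner_integral_exp_abs[OF True, of x, THEN has_bochner_integral_integral_eq] whitham_density_nonneg[of s]
      by (simp add: abs_mult)
  next
    case False
    then have "whitham_density s = 0" using pi_gt_zero by (intro whitham_density_eq_0) linarith
    then show ?thesis by simp
  qed
  show "integrable lborel (\<lambda>s. LINT y|lborel. norm (case (s, y) of (s, y) \<Rightarrow> whitham_density s * exp (- (s * \<bar>x - y\<bar>))))"
    unfolding prod.case inner by (intro integrable_mult_right integrable_whitham_density_over_id)
  show "AE s in lborel. integrable lborel (\<lambda>y. case (s, y) of (s, y) \<Rightarrow> whitham_density s * exp (- (s * \<bar>x - y\<bar>)))"
  proof (rule AE_I2)
    fix s :: real
    show "integrable lborel (\<lambda>y. case (s, y) of (s, y) \<Rightarrow> whitham_density s * exp (- (s * \<bar>x - y\<bar>)))"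
    proof (cases "0 < s")
      case True
      then show ?thesis
        using has_bochner_integral_exp_abs[OF True, of x] by (auto simp: has_bochner_integral_iff)
    next
      case False
      then have "whitham_density s = 0" using pi_gt_zero by (intro whitham_density_eq_0) linarith
      then show ?thesis by simp
    qed
  qed
qed measurable

lemma whitham_kernel_measurable [measurable]: "whitham_kernel \<in> borel_measurable borel"
proof -
  have "whitham_kernel = (\<lambda>x. if x = 0 then whitham_kernel 0 else LINT s|lborel. whitham_density s * exp (- (s * \<bar>x\<bar>)))"
    by (auto simp: whitham_kernel_eq_laplace)
  also have "\<dots> \<in> borel_measurable borel" by measurable
  finally show ?thesis .
qed

text \<open>
  Fubini for bounded \<open>f\<close>. The Laplace representation fails at the dummy value of the kernel at \<open>0\<close>,
  that is for \<open>y = x\<close> only, so the integrands agree almost everywhere.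
\<close>

lemma
  fixes f :: "real \<Rightarrow> real"
  assumes [measurable]: "f \<in> borel_measurable borel" and bd: "\<And>y. \<bar>f y\<bar> \<le> M"
  shows integrable_whitham_kernel_mult: "integrable lborel (\<lambda>y. whitham_kernel (x - y) * f y)"
    and integrable_density_resolvent: "integrable lborel (\<lambda>s. whitham_density s * resolvent_op s f x)"
    and whitham_op_eq_resolvent: "whitham_op f x = (LINT s|lborel. whitham_density s * resolvent_op s f x)"
proof -
  define h where "h = (\<lambda>s y. whitham_density s * exp (- (s * \<bar>x - y\<bar>)) * f y)"
  have I: "integrable (lborel \<Otimes>\<^sub>M lborel) (\<lambda>(s, y). h s y)"
  proof (rule Bochner_Integration.integrable_bound[OF integrable_mult_right[OF integrable_density_exp_product[of x], of M]])
    show "AE z in lborel \<Otimes>\<^sub>M lborel. norm (case z of (s, y) \<Rightarrow> h s y) \<le>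
      norm (M * (case z of (s, y) \<Rightarrow> whitham_density s * exp (- (s * \<bar>x - y\<bar>))))"
    proof (rule AE_I2, clarify)
      fix s y :: real
      have "\<bar>f y\<bar> * (whitham_density s * exp (- (s * \<bar>x - y\<bar>))) \<le> \<bar>M\<bar> * (whitham_density s * exp (- (s * \<bar>x - y\<bar>)))"
        using bd[of y] whitham_density_nonneg[of s] by (intro mult_right_mono) auto
      then show "norm (h s y) \<le> norm (M * (whitham_density s * exp (- (s * \<bar>x - y\<bar>))))"
        using whitham_density_nonneg[of s] by (simp add: h_def abs_mult mult_ac)
    qed
  qed (simp add: h_def)
  have ker: "AE y in lborel. (LINT s|lborel. h s y) = whitham_kernel (x - y) * f y"
    using AE_lborel_singleton[of x]
    by eventually_elim (simp add: h_def whitham_kernel_eq_laplace)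
  have res: "(LINT y|lborel. h s y) = whitham_density s * resolvent_op s f x" for s
    by (simp add: h_def resolvent_op_def mult.assoc)
  have "integrable lborel (\<lambda>y. LINT s|lborel. h s y)"
    using lborel_pair.integrable_snd[OF I] by simp
  moreover have [measurable]: "case_prod h \<in> borel_measurable (lborel \<Otimes>\<^sub>M lborel)"
    using I by (auto simp: case_prod_eta dest: borel_measurable_integrable)
  ultimately show "integrable lborel (\<lambda>y. whitham_kernel (x - y) * f y)"
    by (subst (asm) integrable_cong_AE[OF _ _ ker]) (auto simp: h_def)
  show "integrable lborel (\<lambda>s. whitham_density s * resolvent_op s f x)"
    using lborel_pair.integrable_fst[OF I] by (simp add: res)
  have "whitham_op f x = (LINT y|lborel. LINT s|lborel. h s y)"
    unfolding whitham_op_def by (rule integral_cong_AE[symmetric, OF _ _ ker]) (auto simp: h_def)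
  also have "\<dots> = (LINT s|lborel. LINT y|lborel. h s y)"
    by (rule lborel_pair.Fubini_integral[OF I])
  finally show "whitham_op f x = (LINT s|lborel. whitham_density s * resolvent_op s f x)"
    by (simp add: res)
qed

section \<open>Coercivity on odd periodic functions\<close>

text \<open>
  Odd functions of period \<open>P\<close> satisfy Dirichlet conditions at \<open>0\<close> and \<open>P/2\<close>, so on them the
  resolvent has, up to a constant factor, the Green kernel
  \<open>sinh (s * min p y) * sinh (s * (P/2 - max p y)) / sinh (s * P/2)\<close>. With \<open>E = exp (- s P)\<close>
  the second factor is proportional to \<open>exp (- s h) - E * exp (s h)\<close>, \<open>h = max p y\<close>. The identity
  brings the case \<open>y < p\<close> of the kernel, as it arises from the method of images, into this
  product form.
\<close>

lemma reflected_kernel_factorization: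
  fixes s p y E :: real
  shows "(exp (s * p) - exp (- (s * p))) * (exp (- (s * y)) - E * exp (s * y))
      - (1 - E) * (exp (s * (p - y)) - exp (- (s * (p - y))))
    = (exp (s * y) - exp (- (s * y))) * (exp (- (s * p)) - E * exp (s * p))"
proof -
  have "exp (s * (p - y)) = exp (s * p) * exp (- (s * y))" "exp (- (s * (p - y))) = exp (- (s * p)) * exp (s * y)"
    by (simp_all add: algebra_simps flip: exp_add)
  then show ?thesis by (simp only:) (simp add: algebra_simps)
qed

lemma green_product_nonneg:
  fixes s lo hi P :: real
  assumes "0 < s" "0 \<le> lo" "hi \<le> P / 2"
  shows "0 \<le> (exp (s * lo) - exp (- (s * lo))) * (exp (- (s * hi)) - exp (- (s * P)) * exp (s * hi))"
proof (rule mult_nonneg_nonneg)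
  have "- (s * lo) \<le> s * lo" using assms by simp
  then show "0 \<le> exp (s * lo) - exp (- (s * lo))" by simp
  have "s * (2 * hi) \<le> s * P" using assms by (intro mult_left_mono) auto
  then have "- (s * P) + s * hi \<le> - (s * hi)" by (simp add: algebra_simps)
  then show "0 \<le> exp (- (s * hi)) - exp (- (s * P)) * exp (s * hi)" by (simp flip: exp_add)
qed

text \<open>
  The value of the product at \<open>min p y = 1\<close>, \<open>max p y = 2\<close> and \<open>P = 8\<close>, which is the worst case
  for \<open>p\<close> and \<open>y\<close> in \<open>[1, 2]\<close> and \<open>P \<ge> 8\<close>.
\<close>

definition green_lower_bound :: "real \<Rightarrow> real" where
  "green_lower_bound s = (exp s - exp (- s)) * (exp (- (2 * s)) - exp (- (8 * s)) * exp (2 * s))"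

lemma green_lower_bound_pos: "0 < s \<Longrightarrow> 0 < green_lower_bound s"
  unfolding green_lower_bound_def by (intro mult_pos_pos) (auto simp flip: exp_add)

lemma green_product_ge:
  fixes s lo hi P :: real
  assumes s: "0 < s" and lo: "1 \<le> lo" and hi: "hi \<le> 2" and P: "8 \<le> P"
  shows "green_lower_bound s \<le> (exp (s * lo) - exp (- (s * lo))) * (exp (- (s * hi)) - exp (- (s * P)) * exp (s * hi))"
  unfolding green_lower_bound_def
proof (rule mult_mono)
  have lo': "s \<le> s * lo" using s lo by simp
  then have "exp s \<le> exp (s * lo)" "exp (- (s * lo)) \<le> exp (- s)" by simp_all
  then show A: "exp s - exp (- s) \<le> exp (s * lo) - exp (- (s * lo))" by linarith
  have "exp (- s) \<le> exp s" using s by simp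
  with A show "0 \<le> exp (s * lo) - exp (- (s * lo))" by linarith
  have hi': "s * hi \<le> 2 * s" using s hi by simp
  have P': "8 * s \<le> s * P" using s P by simp
  have "exp (- (s * P)) * exp (s * hi) \<le> exp (- (8 * s)) * exp (2 * s)"
    using hi' P' by (intro mult_mono) auto
  moreover have "exp (- (2 * s)) \<le> exp (- (s * hi))" using hi' by simp
  ultimately show "exp (- (2 * s)) - exp (- (8 * s)) * exp (2 * s) \<le> exp (- (s * hi)) - exp (- (s * P)) * exp (s * hi)"
    by linarith
  show "0 \<le> exp (- (2 * s)) - exp (- (8 * s)) * exp (2 * s)" using s by (simp flip: exp_add)
qed

lemma integrable_bounded_on_interval:
  fixes g :: "real \<Rightarrow> real"
  assumes [measurable]: "g \<in> borel_measurable borel" and "\<And>y. y \<in> {a..b} \<Longrightarrow> \<bar>g y\<bar> \<le> B"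
    and "A \<in> sets borel" "A \<subseteq> {a..b}"
  shows "integrable lborel (\<lambda>y. indicator A y * g y)"
proof (rule Bochner_Integration.integrable_bound)
  show "integrable lborel (\<lambda>y. indicator {a..b} y * B :: real)"
    by (intro integrable_mult_left integrable_real_indicator) (auto simp: emeasure_lborel_Icc_eq)
  show "AE y in lborel. norm (indicator A y * g y) \<le> norm (indicator {a..b} y * B)"
    using assms(2,4) by (intro AE_I2) (force simp: indicator_def)
  show "(\<lambda>y. indicator A y * g y) \<in> borel_measurable lborel"
    using assms(3) by measurable
qed

text \<open>
  The Green kernel is derived by folding the integral over the line in two steps. Oddness folds it
  onto the half-line, where it splits into a multiple of the Laplace transform \<open>J\<close> of \<open>e\<close> and a
  correction supported in \<open>[0, p)\<close>. Shifting by one period, then reflecting at \<open>0\<close> and at \<open>P/2\<close>,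
  expresses \<open>(1 - E) * J\<close> through \<open>e\<close> on \<open>[0, P/2]\<close>. All of this kernel is nonnegative, so only
  the part over \<open>[1, 2]\<close> is kept; the factor \<open>1 - E < 1\<close> can then be dropped.
\<close>

lemma resolvent_op_odd_periodic_ge:
  fixes e :: "real \<Rightarrow> real"
  assumes [measurable]: "e \<in> borel_measurable borel" and bd: "\<And>y. \<bar>e y\<bar> \<le> M"
    and odd: "\<And>y. e (- y) = - e y" and per: "\<And>y. e (y + P) = e y"
    and nonneg: "\<And>y. 0 \<le> y \<Longrightarrow> y \<le> P / 2 \<Longrightarrow> 0 \<le> e y"
    and P: "8 \<le> P" and s: "0 < s" and p: "1 \<le> p" "p \<le> 2"
    and m: "0 \<le> m" "\<And>y. 1 \<le> y \<Longrightarrow> y \<le> 2 \<Longrightarrow> m \<le> e y"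
  shows "green_lower_bound s * m \<le> resolvent_op s e p"
proof -
  define E where "E = exp (- (s * P))"
  have E: "0 < E" "E < 1" using s P by (auto simp: E_def)
  have M0: "0 \<le> M" using bd[of 0] by linarith
  have e0: "e 0 = 0" using odd[of 0] by simp
  have mirror: "e (P - y) = - e y" for y using per[of "- y"] odd[of y] by simp
  have eP: "e (P / 2) = 0" using mirror[of "P / 2"] by simp
  define u where "u = (\<lambda>y. indicator {0..} y * exp (- (s * y)) * e y)"
  define v where "v = (\<lambda>y. indicator {- P..<0} y * (exp (- (s * y)) * e y))"
  define q where "q = (\<lambda>y. indicator {0..P / 2} y * (exp (s * y) * e y))"
  define r where "r = (\<lambda>y. indicator {P / 2<..P} y * (exp (s * y) * e y))"
  define t where "t = (\<lambda>y. indicator {0..P / 2} y * (exp (- (s * y)) * e y))"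
  define z where "z = (\<lambda>y. indicator {0..<p} y * ((exp (s * (p - y)) - exp (- (s * (p - y)))) * e y))"
  define F where "F = (\<lambda>y. exp (- (s * \<bar>p - y\<bar>)) * e y)"
  have ebd: "\<bar>exp c * e y\<bar> \<le> exp C * M" if "c \<le> C" for c C y
    unfolding abs_mult using that bd[of y] M0 by (intro mult_mono) auto
  have iu: "integrable lborel u"
  proof (rule Bochner_Integration.integrable_bound)
    show "integrable lborel (\<lambda>y. M * (indicator {0..} y * exp (- (s * y))))"
      using has_bochner_integral_exp_half_line[OF s] by (intro integrable_mult_right) (auto simp: has_bochner_integral_iff)
    show "AE y in lborel. norm (u y) \<le> norm (M * (indicator {0..} y * exp (- (s * y))))"
      using bd M0 by (intro AE_I2) (auto simp: u_def indicator_def abs_mult mult.commute mult_right_mono)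
  qed (simp add: u_def)
  have iF: "integrable lborel F"
  proof (rule Bochner_Integration.integrable_bound)
    show "integrable lborel (\<lambda>y. M * exp (- (s * \<bar>p - y\<bar>)))"
      using has_bochner_integral_exp_abs[OF s, of p] by (intro integrable_mult_right) (auto simp: has_bochner_integral_iff)
    show "AE y in lborel. norm (F y) \<le> norm (M * exp (- (s * \<bar>p - y\<bar>)))"
      using bd M0 by (intro AE_I2) (auto simp: F_def abs_mult mult.commute mult_right_mono)
  qed (simp add: F_def)
  have iv: "integrable lborel v"
    unfolding v_def
  proof (rule integrable_bounded_on_interval[where a = "- P" and b = 0 and B = "exp (s * P) * M"])
    fix y assume "y \<in> {- P..0}"
    then have "s * (- y) \<le> s * P" using s by (intro mult_left_mono) auto
    then show "\<bar>exp (- (s * y)) * e y\<bar> \<le> exp (s * P) * M" by (intro ebd) simp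
  qed auto
  have sP: "\<bar>exp (s * y) * e y\<bar> \<le> exp (s * P) * M" if "y \<in> {0..P}" for y
    using that s by (intro ebd mult_left_mono) auto
  have iq: "integrable lborel q"
    unfolding q_def by (rule integrable_bounded_on_interval[OF _ sP]) (use P in auto)
  have ir: "integrable lborel r"
    unfolding r_def by (rule integrable_bounded_on_interval[OF _ sP]) (use P in auto)
  have it: "integrable lborel t"
    unfolding t_def
  proof (rule integrable_bounded_on_interval[where a = 0 and b = P and B = "exp 0 * M"])
    fix y assume "y \<in> {0..P}"
    then have "0 \<le> s * y" using s by simp
    then show "\<bar>exp (- (s * y)) * e y\<bar> \<le> exp 0 * M" by (intro ebd) simp
  qed (use P in auto)
  have iz: "integrable lborel z"
    unfolding z_def
  proof (rule integrable_bounded_on_interval[where a = 0 and b = p and B = "(exp (s * p) + 1) * M"])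
    fix y assume y: "y \<in> {0..p}"
    have "\<bar>exp (s * (p - y)) * e y\<bar> \<le> exp (s * p) * M" using y s by (intro ebd) auto
    moreover have "\<bar>exp (- (s * (p - y))) * e y\<bar> \<le> exp 0 * M" using y s by (intro ebd) auto
    ultimately show "\<bar>(exp (s * (p - y)) - exp (- (s * (p - y)))) * e y\<bar> \<le> (exp (s * p) + 1) * M"
      by (simp add: algebra_simps)
  qed auto
  define J where "J = (LINT y|lborel. u y)"
  have J1: "J = E * (J + (LINT y|lborel. v y))"
  proof -
    have "J = \<bar>1\<bar> *\<^sub>R (LINT y|lborel. u (P + 1 * y))"
      unfolding J_def by (rule lborel_integral_real_affine) simp
    also have "\<dots> = (LINT y|lborel. E * (u y + v y))"
      using P per by (auto intro!: Bochner_Integration.integral_cong simp: u_def v_def E_def indicator_def algebra_simps exp_add[symmetric] add.commute[of P])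
    also have "\<dots> = E * (J + (LINT y|lborel. v y))"
      using iu iv by (simp add: J_def)
    finally show ?thesis .
  qed
  have V: "(LINT y|lborel. v y) = - (LINT y|lborel. q y) - (LINT y|lborel. r y)"
  proof -
    have "(LINT y|lborel. v y) = \<bar>-1\<bar> *\<^sub>R (LINT y|lborel. v (0 + -1 * y))"
      by (rule lborel_integral_real_affine) simp
    also have "\<dots> = (LINT y|lborel. - q y - r y)"
    proof (simp only: abs_minus_cancel abs_one scaleR_one, rule Bochner_Integration.integral_cong[OF refl])
      fix y :: real
      consider "y < 0" | "y = 0" | "0 < y" "y \<le> P / 2" | "P / 2 < y" "y \<le> P" | "P < y" by linarith
      then show "v (0 + -1 * y) = - q y - r y"
        by cases (use P odd[of y] e0 in \<open>auto simp: v_def q_def r_def\<close>)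
    qed
    finally show ?thesis using iq ir by simp
  qed
  have R: "E * (LINT y|lborel. r y) = - (LINT y|lborel. t y)"
  proof -
    have "(LINT y|lborel. r y) = \<bar>-1\<bar> *\<^sub>R (LINT y|lborel. r (P + -1 * y))"
      by (rule lborel_integral_real_affine) simp
    also have "\<dots> = (LINT y|lborel. - exp (s * P) * t y)"
    proof (simp only: abs_minus_cancel abs_one scaleR_one, rule Bochner_Integration.integral_cong[OF refl])
      fix y :: real
      have ex: "exp (s * (P - y)) = exp (s * P) * exp (- (s * y))"
        by (simp add: algebra_simps flip: exp_add)
      consider "y < 0" | "0 \<le> y" "y < P / 2" | "y = P / 2" | "P / 2 < y" by linarith
      then show "r (P + -1 * y) = - exp (s * P) * t y"
        by cases (use P mirror[of y] eP ex in \<open>auto simp: r_def t_def\<close>)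
    qed
    also have "\<dots> = - exp (s * P) * (LINT y|lborel. t y)" by simp
    finally show ?thesis by (simp add: E_def exp_minus)
  qed
  have J2: "(1 - E) * J = (LINT y|lborel. t y) - E * (LINT y|lborel. q y)"
    using J1 R unfolding V by (simp add: algebra_simps)
  have T: "resolvent_op s e p = (exp (s * p) - exp (- (s * p))) * J - (LINT y|lborel. z y)"
  proof -
    define Fn where "Fn = (\<lambda>y. indicator {..<0} y * F y)"
    define Fp where "Fp = (\<lambda>y. indicator {0..} y * F y)"
    have ip: "integrable lborel Fp" "integrable lborel Fn"
      unfolding Fp_def Fn_def using iF
      by (auto intro!: integrable_mult_indicator[where 'b = real, simplified])
    have ir': "integrable lborel (\<lambda>y. Fn (0 + -1 * y))"
      using ip(2) by (subst (asm) lborel_integrable_real_affine_iff[of "-1" _ 0, symmetric]) auto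
    have "resolvent_op s e p = (LINT y|lborel. F y)" by (simp add: resolvent_op_def F_def)
    also have "\<dots> = (LINT y|lborel. Fp y + Fn y)"
      by (intro Bochner_Integration.integral_cong) (auto simp: Fp_def Fn_def indicator_def)
    also have "\<dots> = (LINT y|lborel. Fp y) + (LINT y|lborel. Fn y)"
      using ip by simp
    also have "(LINT y|lborel. Fn y) = \<bar>-1\<bar> *\<^sub>R (LINT y|lborel. Fn (0 + -1 * y))"
      by (rule lborel_integral_real_affine) simp
    also have "(LINT y|lborel. Fp y) + \<bar>-1\<bar> *\<^sub>R (LINT y|lborel. Fn (0 + -1 * y)) = (LINT y|lborel. Fp y + Fn (0 + -1 * y))"
      using ip(1) ir' by simp
    also have "\<dots> = (LINT y|lborel. (exp (s * p) - exp (- (s * p))) * u y - z y)"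
    proof (rule Bochner_Integration.integral_cong[OF refl])
      fix y :: real
      consider "y < 0" | "y = 0" | "0 < y" "y < p" | "p \<le> y" "0 < y" by linarith
      then show "Fp y + Fn (0 + -1 * y) = (exp (s * p) - exp (- (s * p))) * u y - z y"
      proof cases
        case 1
        then show ?thesis by (simp add: Fp_def Fn_def u_def z_def)
      next
        case 2
        then show ?thesis by (simp add: Fp_def Fn_def u_def z_def e0 F_def)
      next
        case 3
        have "exp (- (s * \<bar>p - y\<bar>)) = exp (- (s * (p - y)))" using 3 by simp
        moreover have "exp (- (s * \<bar>p + y\<bar>)) = exp (- (s * p)) * exp (- (s * y))"
          using 3 p by (simp add: algebra_simps flip: exp_add)
        moreover have "exp (s * (p - y)) = exp (s * p) * exp (- (s * y))"
          by (simp add: algebra_simps flip: exp_add)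
        ultimately show ?thesis using 3 odd[of y]
          by (simp add: Fp_def Fn_def u_def z_def F_def) (simp add: algebra_simps)
      next
        case 4
        have "exp (- (s * \<bar>p - y\<bar>)) = exp (s * p) * exp (- (s * y))"
          using 4 by (simp add: algebra_simps flip: exp_add)
        moreover have "exp (- (s * \<bar>p + y\<bar>)) = exp (- (s * p)) * exp (- (s * y))"
          using 4 p by (simp add: algebra_simps flip: exp_add)
        ultimately show ?thesis using 4 odd[of y]
          by (simp add: Fp_def Fn_def u_def z_def F_def) (simp add: algebra_simps)
      qed
    qed
    also have "\<dots> = (exp (s * p) - exp (- (s * p))) * J - (LINT y|lborel. z y)"
      using iu iz by (simp add: J_def)
    finally show ?thesis .
  qed
  \<comment> \<open>On \<open>[0, P/2]\<close>, \<open>k\<close> is \<open>e\<close> times \<open>1 - E\<close> times the Green kernel at \<open>p\<close>; it vanishes elsewhere.\<close>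
  define k where "k = (\<lambda>y. (exp (s * p) - exp (- (s * p))) * (t y - E * q y) - (1 - E) * z y)"
  have ik: "integrable lborel k" unfolding k_def using it iq iz by (intro Bochner_Integration.integrable_diff integrable_mult_right)
  have "(1 - E) * resolvent_op s e p = (exp (s * p) - exp (- (s * p))) * ((1 - E) * J) - (1 - E) * (LINT y|lborel. z y)"
    unfolding T by (simp add: algebra_simps)
  also have "\<dots> = (LINT y|lborel. k y)"
    unfolding J2 k_def using it iq iz by simp
  finally have K: "(1 - E) * resolvent_op s e p = (LINT y|lborel. k y)" .
  have kval: "k y = (exp (s * min p y) - exp (- (s * min p y))) * (exp (- (s * max p y)) - E * exp (s * max p y)) * e y"
    if "y \<in> {0..P / 2}" for y
  proof (cases "y < p")
    case True
    have "k y = ((exp (s * p) - exp (- (s * p))) * (exp (- (s * y)) - E * exp (s * y))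
      - (1 - E) * (exp (s * (p - y)) - exp (- (s * (p - y))))) * e y"
      using True that by (simp add: k_def t_def q_def z_def algebra_simps)
    then show ?thesis unfolding reflected_kernel_factorization using True by simp
  next
    case False
    then show ?thesis using that by (simp add: k_def t_def q_def z_def algebra_simps)
  qed
  have "green_lower_bound s * m = (LINT y::real|lborel. indicator {1..2} y * (green_lower_bound s * m))"
    by simp
  also have "\<dots> \<le> (LINT y|lborel. k y)"
  proof (rule integral_mono[OF _ ik])
    show "integrable lborel (\<lambda>y::real. indicator {1..2} y * (green_lower_bound s * m) :: real)"
      by (intro integrable_mult_left integrable_real_indicator) (auto simp: emeasure_lborel_Icc_eq)
    fix y :: real
    show "indicator {1..2} y * (green_lower_bound s * m) \<le> k y"
    proof (cases "y \<in> {0..P / 2}")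
      case True
      have ey: "0 \<le> e y" using True nonneg by simp
      show ?thesis
      proof (cases "y \<in> {1..2}")
        case in12: True
        have "green_lower_bound s * m \<le>
          ((exp (s * min p y) - exp (- (s * min p y))) * (exp (- (s * max p y)) - exp (- (s * P)) * exp (s * max p y))) * e y"
          using in12 p P s m green_lower_bound_pos[OF s]
          by (intro mult_mono green_product_ge green_product_nonneg) auto
        then show ?thesis using in12 kval[OF True] by (simp add: E_def)
      next
        case False
        have "0 \<le> (exp (s * min p y) - exp (- (s * min p y))) * (exp (- (s * max p y)) - exp (- (s * P)) * exp (s * max p y))"
          using True p P s by (intro green_product_nonneg) auto
        then show ?thesis using False kval[OF True] ey by (simp add: E_def)
      qed
    next
      case False
      then have "k y = 0" "y \<notin> {1..2}" using P p by (auto simp: k_def t_def q_def z_def indicator_def)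
      then show ?thesis by simp
    qed
  qed
  finally have main: "green_lower_bound s * m \<le> (1 - E) * resolvent_op s e p" unfolding K .
  moreover have "0 \<le> green_lower_bound s * m" using green_lower_bound_pos[OF s] m by simp
  ultimately have "0 \<le> (1 - E) * resolvent_op s e p" by linarith
  then have "0 \<le> resolvent_op s e p" using E by (simp add: zero_le_mult_iff)
  then have "(1 - E) * resolvent_op s e p \<le> 1 * resolvent_op s e p" using E by (intro mult_right_mono) auto
  with main show ?thesis by simp
qed

definition coercivity_constant :: real where
  "coercivity_constant = (LINT s|lborel. whitham_density s * green_lower_bound s)"

lemma whitham_density_eq_0_nonpos: "s \<le> 0 \<Longrightarrow> whitham_density s = 0"
  using pi_gt_zero by (intro whitham_density_eq_0) linarith

lemma exp_minus_le_inverse: "0 < s \<Longrightarrow> exp (- s) \<le> 1 / (s::real)"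
proof -
  assume s: "0 < s"
  then have "s \<le> exp s" using exp_ge_add_one_self[of s] by linarith
  then show ?thesis using s by (simp add: exp_minus field_simps)
qed

lemma integrable_density_mult:
  fixes g :: "real \<Rightarrow> real"
  assumes [measurable]: "g \<in> borel_measurable borel"
    and g: "\<And>s. 0 < s \<Longrightarrow> 0 \<le> g s" "\<And>s. 0 < s \<Longrightarrow> g s \<le> B / s"
  shows "integrable lborel (\<lambda>s. whitham_density s * g s)"
proof (rule Bochner_Integration.integrable_bound)
  show "integrable lborel (\<lambda>s. B * (whitham_density s / s))"
    by (intro integrable_mult_right integrable_whitham_density_over_id)
  show "AE s in lborel. norm (whitham_density s * g s) \<le> norm (B * (whitham_density s / s))"
  proof (rule AE_I2)
    fix s :: real
    show "norm (whitham_density s * g s) \<le> norm (B * (whitham_density s / s))"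
    proof (cases "0 < s")
      case True
      have "whitham_density s * g s \<le> whitham_density s * (B / s)"
        using g(2)[OF True] whitham_density_nonneg by (intro mult_left_mono)
      also have "\<dots> = B * (whitham_density s / s)" by simp
      also have "\<dots> \<le> norm (B * (whitham_density s / s))" by (simp only: real_norm_def abs_ge_self)
      finally show ?thesis
        using g(1)[OF True] whitham_density_nonneg[of s] by simp
    qed (simp add: whitham_density_eq_0_nonpos)
  qed
qed measurable

lemma green_lower_bound_measurable [measurable]: "green_lower_bound \<in> borel_measurable borel"
  unfolding green_lower_bound_def by measurable

lemma integrable_density_green_lower_bound:
  "integrable lborel (\<lambda>s. whitham_density s * green_lower_bound s)"
proof (rule integrable_density_mult)
  fix s :: real assume s: "0 < s"
  show "0 \<le> green_lower_bound s" using green_lower_bound_pos[OF s] by simp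
  have "green_lower_bound s \<le> exp s * exp (- (2 * s))"
    unfolding green_lower_bound_def using s by (intro mult_mono) (auto simp flip: exp_add)
  also have "\<dots> = exp (- s)" by (simp flip: exp_add)
  also have "\<dots> \<le> 1 / s" by (rule exp_minus_le_inverse[OF s])
  finally show "green_lower_bound s \<le> 1 / s" .
qed measurable

lemma coercivity_constant_pos: "0 < coercivity_constant"
  unfolding coercivity_constant_def
proof (rule integral_pos_of_pos_on_interval[OF integrable_density_green_lower_bound])
  show "0 \<le> whitham_density s * green_lower_bound s" for s
    using whitham_density_nonneg[of s] green_lower_bound_pos[of s]
    by (cases "0 < s") (auto simp: whitham_density_eq_0_nonpos)
  show "pi / 2 < pi" by simp
  fix s :: real assume s: "pi / 2 < s" "s < pi"
  then have "0 < s" using pi_gt_zero by linarith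
  then show "0 < whitham_density s * green_lower_bound s"
    using whitham_density_pos[OF s] green_lower_bound_pos by simp
qed

text \<open>
  Integration of the resolvent estimate against the density. The constant does not depend on the
  period, which is what makes the speed bound uniform.
\<close>

lemma whitham_op_odd_periodic_ge:
  fixes e :: "real \<Rightarrow> real"
  assumes [measurable]: "e \<in> borel_measurable borel" and bd: "\<And>y. \<bar>e y\<bar> \<le> M"
    and odd: "\<And>y. e (- y) = - e y" and per: "\<And>y. e (y + P) = e y"
    and nonneg: "\<And>y. 0 \<le> y \<Longrightarrow> y \<le> P / 2 \<Longrightarrow> 0 \<le> e y"
    and P: "8 \<le> P" and p: "1 \<le> p" "p \<le> 2"
    and m: "0 \<le> m" "\<And>y. 1 \<le> y \<Longrightarrow> y \<le> 2 \<Longrightarrow> m \<le> e y"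
  shows "coercivity_constant * m \<le> whitham_op e p"
proof -
  have "coercivity_constant * m = (LINT s|lborel. whitham_density s * green_lower_bound s * m)"
    by (simp add: coercivity_constant_def)
  also have "\<dots> \<le> (LINT s|lborel. whitham_density s * resolvent_op s e p)"
  proof (rule integral_mono)
    show "integrable lborel (\<lambda>s. whitham_density s * green_lower_bound s * m)"
      by (intro integrable_mult_left integrable_density_green_lower_bound)
    show "integrable lborel (\<lambda>s. whitham_density s * resolvent_op s e p)"
      by (rule integrable_density_resolvent[OF _ bd]) simp
    fix s :: real
    show "whitham_density s * green_lower_bound s * m \<le> whitham_density s * resolvent_op s e p"
    proof (cases "0 < s")
      case True
      then show ?thesis
        using resolvent_op_odd_periodic_ge[OF assms(1) bd odd per nonneg P True p m] whitham_density_nonneg[of s]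
        by (simp add: mult.assoc mult_left_mono)
    qed (simp add: whitham_density_eq_0_nonpos)
  qed
  also have "\<dots> = whitham_op e p"
    by (rule whitham_op_eq_resolvent[symmetric, OF _ bd]) simp
  finally show ?thesis .
qed

lemma integrable_density_exp:
  assumes "0 < a"
  shows "integrable lborel (\<lambda>s. whitham_density s * exp (- (s * a)))"
proof (rule integrable_density_mult)
  fix s :: real assume "0 < s"
  then show "exp (- (s * a)) \<le> (1 / a) / s"
    using exp_minus_le_inverse[of "s * a"] assms by (simp add: mult.commute)
qed auto

lemma whitham_kernel_nonneg: "x \<noteq> 0 \<Longrightarrow> 0 \<le> whitham_kernel x"
  by (simp add: whitham_kernel_eq_laplace whitham_density_nonneg)

lemma whitham_kernel_pos: "x \<noteq> 0 \<Longrightarrow> 0 < whitham_kernel x"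
  unfolding whitham_kernel_eq_laplace
  by (rule integral_pos_of_pos_on_interval[OF integrable_density_exp, of _ "pi / 2" pi])
     (auto simp: whitham_density_nonneg whitham_density_pos)

lemma whitham_kernel_antimono:
  assumes "x \<noteq> 0" "\<bar>x\<bar> \<le> \<bar>y\<bar>"
  shows "whitham_kernel y \<le> whitham_kernel x"
proof -
  have y: "y \<noteq> 0" using assms by auto
  show ?thesis
    unfolding whitham_kernel_eq_laplace[OF assms(1)] whitham_kernel_eq_laplace[OF y]
  proof (rule integral_mono)
    fix s :: real
    show "whitham_density s * exp (- (s * \<bar>y\<bar>)) \<le> whitham_density s * exp (- (s * \<bar>x\<bar>))"
      using assms(2) whitham_density_nonneg[of s]
      by (cases "0 < s") (auto simp: whitham_density_eq_0_nonpos intro!: mult_left_mono)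
  qed (use assms(1) y in \<open>auto intro: integrable_density_exp\<close>)
qed

lemma whitham_op_translate: "whitham_op f (x + a) = whitham_op (\<lambda>y. f (y + a)) x"
proof -
  have "whitham_op f (x + a) = \<bar>1\<bar> *\<^sub>R (LINT y|lborel. whitham_kernel (x + a - (a + 1 * y)) * f (a + 1 * y))"
    unfolding whitham_op_def by (rule lborel_integral_real_affine) simp
  then show ?thesis by (simp add: whitham_op_def add.commute)
qed

lemma whitham_op_diff:
  fixes f g :: "real \<Rightarrow> real"
  assumes "f \<in> borel_measurable borel" "\<And>y. \<bar>f y\<bar> \<le> M"
    and "g \<in> borel_measurable borel" "\<And>y. \<bar>g y\<bar> \<le> M"
  shows "whitham_op (\<lambda>y. f y - g y) x = whitham_op f x - whitham_op g x"
  using integrable_whitham_kernel_mult[OF assms(1,2), of x] integrable_whitham_kernel_mult[OF assms(3,4), of x]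
  by (simp add: whitham_op_def right_diff_distrib)

definition whitham_kernel_mass :: real where
  "whitham_kernel_mass = whitham_op (\<lambda>_. 1) 0"

lemma whitham_kernel_mass_nonneg: "0 \<le> whitham_kernel_mass"
  unfolding whitham_kernel_mass_def whitham_op_def
proof (rule integral_nonneg_AE)
  show "AE y in lborel. 0 \<le> whitham_kernel (0 - y) * 1"
    using AE_lborel_singleton[of 0] by eventually_elim (simp add: whitham_kernel_nonneg)
qed

text \<open>
  On \<open>[3, 4]\<close> the kernel is at least \<open>K(4)\<close>, so negativity of \<open>f\<close> there lowers the
  average \<open>L f(0)\<close> by a definite amount; elsewhere \<open>f\<close> is replaced by its upper bound.
\<close>

lemma whitham_op_le_of_negative_part:
  fixes f :: "real \<Rightarrow> real"
  assumes meas: "f \<in> borel_measurable borel" and bd: "\<And>y. \<bar>f y\<bar> \<le> M"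
    and top: "\<And>y. f y \<le> b" and b: "0 \<le> b" and d: "d \<le> 0"
    and low: "\<And>y. 3 \<le> y \<Longrightarrow> y \<le> 4 \<Longrightarrow> f y \<le> d"
  shows "whitham_op f 0 \<le> b * whitham_kernel_mass + whitham_kernel 4 * d"
proof -
  have ik: "integrable lborel (\<lambda>y. whitham_kernel (0 - y) * 1)"
    by (rule integrable_whitham_kernel_mult[where M = 1]) auto
  have ii: "integrable lborel (\<lambda>y::real. indicator {3..4} y * (whitham_kernel 4 * d))"
    by (intro integrable_mult_left integrable_real_indicator) (auto simp: emeasure_lborel_Icc_eq)
  have "whitham_op f 0 \<le> (LINT y|lborel. b * (whitham_kernel (0 - y) * 1) + indicator {3..4} y * (whitham_kernel 4 * d))"
    unfolding whitham_op_def
  proof (rule integral_mono_AE)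
    show "integrable lborel (\<lambda>y. whitham_kernel (0 - y) * f y)"
      by (rule integrable_whitham_kernel_mult[OF meas bd])
    show "integrable lborel (\<lambda>y. b * (whitham_kernel (0 - y) * 1) + indicator {3..4} y * (whitham_kernel 4 * d))"
      using ik ii by (intro Bochner_Integration.integrable_add integrable_mult_right)
    show "AE y in lborel. whitham_kernel (0 - y) * f y \<le> b * (whitham_kernel (0 - y) * 1) + indicator {3..4} y * (whitham_kernel 4 * d)"
      using AE_lborel_singleton[of 0]
    proof eventually_elim
      case (elim y)
      have K: "0 \<le> whitham_kernel (- y)" using elim by (simp add: whitham_kernel_nonneg)
      show ?case
      proof (cases "y \<in> {3..4}")
        case True
        have "whitham_kernel (- y) * f y \<le> whitham_kernel (- y) * d"
          using K low True by (intro mult_left_mono) auto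
        also have "\<dots> \<le> whitham_kernel 4 * d"
          using d True elim whitham_kernel_antimono[of "- y" 4] by (intro mult_right_mono_neg) auto
        finally show ?thesis using True K b by simp (smt (verit) mult_nonneg_nonneg)
      next
        case False
        have "whitham_kernel (- y) * f y \<le> whitham_kernel (- y) * b"
          using K top by (intro mult_left_mono) auto
        then show ?thesis using False by (simp add: mult.commute)
      qed
    qed
  qed
  also have "\<dots> = b * whitham_kernel_mass + whitham_kernel 4 * d"
    using ik ii by (simp add: whitham_kernel_mass_def whitham_op_def)
  finally show ?thesis .
qed

section \<open>A uniform lower bound for the wave speed\<close>

lemma continuous_of_hoelder_half:
  assumes "f \<in> hoelder_space (1 / 2)"
  shows "continuous_on UNIV f"
proof -
  obtain C where C: "\<And>x y. \<bar>f x - f y\<bar> \<le> C * \<bar>x - y\<bar> powr (1 / 2)"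
    using assms by (auto simp: hoelder_space_def)
  have "isCont f x" for x
    unfolding isCont_def
  proof (rule LIM_zero_cancel, rule Lim_null_comparison)
    show "\<forall>\<^sub>F y in at x. norm (f y - f x) \<le> C * sqrt \<bar>y - x\<bar>"
      using C by (intro always_eventually) (simp add: powr_half_sqrt)
    have "((\<lambda>y. C * sqrt \<bar>y - x\<bar>) \<longlongrightarrow> C * sqrt \<bar>x - x\<bar>) (at x)"
      by (intro tendsto_intros)
    then show "((\<lambda>y. C * sqrt \<bar>y - x\<bar>) \<longlongrightarrow> 0) (at x)" by simp
  qed
  then show ?thesis by (simp add: continuous_on_eq_continuous_at)
qed

lemma admissible_strictly_decreasing:
  assumes adm: "admissible_pair P \<eta> f \<mu>" and xy: "0 < x" "x < y" "y < P / 2"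
  shows "f y < f x"
proof -
  have ev: "f (- x) = f x" for x using adm by (simp add: admissible_pair_def)
  have "strict_mono_on {- P / 2<..<0} f" using adm by (simp add: admissible_pair_def)
  then have "f (- y) < f (- x)" by (rule strict_mono_onD) (use xy in auto)
  then show ?thesis by (simp add: ev)
qed

lemma admissible_decreasing:
  assumes adm: "admissible_pair P \<eta> f \<mu>" and xy: "0 \<le> x" "x \<le> y" "y \<le> P / 2"
  shows "f y \<le> f x"
proof -
  have f0: "f x \<le> f 0" for x using adm by (simp add: admissible_pair_def)
  have cont: "continuous_on UNIV f"
    using adm by (auto simp: admissible_pair_def intro: continuous_of_hoelder_half)
  note str = admissible_strictly_decreasing[OF adm]
  consider "x = 0" | "x = y" | "0 < x" "x < y" "y < P / 2" | "0 < x" "x < y" "y = P / 2"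
    using xy by linarith
  then show ?thesis
  proof cases
    case 4
    \<comment> \<open>Monotonicity is only known on the open half period; continuity extends it to the trough.\<close>
    have "(f \<longlongrightarrow> f y) (at_left y)"
      using cont by (auto simp: continuous_on_eq_continuous_at isCont_def intro: filterlim_at_split[THEN iffD1, THEN conjunct1])
    moreover have "\<forall>\<^sub>F z in at_left y. f z \<le> f x"
      using eventually_at_left_real[of x y] 4(2)
      by (auto elim!: eventually_mono intro!: less_imp_le str simp: 4)
    ultimately show ?thesis by (rule tendsto_upperbound) simp
  qed (use f0 str[of x y] in auto)
qed

text \<open>
  The difference \<open>e\<close> of two translates is used at its minimum point \<open>p\<close> on \<open>[1, 2]\<close>, so that
  \<open>e p\<close> itself can serve as the lower bound \<open>m\<close> in the coercivity estimate and cancels.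
  For \<open>P \<ge> 8\<close> the points \<open>p \<plusminus> 1/2\<close> and \<open>3\<close> all lie in the half period where \<open>f\<close> decreases.
\<close>

lemma speed_ge_coercivity:
  assumes adm: "admissible_pair P \<eta> f \<mu>" and P: "8 \<le> P"
  shows "coercivity_constant \<le> \<mu> - 2 * f 3"
proof -
  have ev: "f (- x) = f x" for x using adm by (simp add: admissible_pair_def)
  have per: "f (x + P) = f x" for x using adm by (simp add: admissible_pair_def)
  have hoe: "f \<in> hoelder_space (1 / 2)" using adm by (simp add: admissible_pair_def)
  have cont: "continuous_on UNIV f" by (rule continuous_of_hoelder_half[OF hoe])
  have meas [measurable]: "f \<in> borel_measurable borel" by (rule borel_measurable_continuous_onI[OF cont])
  obtain M where M: "\<And>y. \<bar>f y\<bar> \<le> M"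
    using hoe by (auto simp: hoelder_space_def bounded_iff)
  have eqn: "whitham_op f x = \<mu> * f x - (f x)\<^sup>2" for x
    using adm by (simp add: admissible_pair_def steady_whitham_def algebra_simps)
  note dec = admissible_decreasing[OF adm]
  define e where "e = (\<lambda>q. f (q - 1 / 2) - f (q + 1 / 2))"
  have ce: "continuous_on UNIV e"
    unfolding e_def by (intro continuous_intros continuous_on_compose2[OF cont]) auto
  have oe: "e (- q) = - e q" for q
    using ev[of "q + 1 / 2"] ev[of "q - 1 / 2"] by (simp add: e_def)
  have pe: "e (q + P) = e q" for q
    using per[of "q + 1 / 2"] per[of "q - 1 / 2"] by (simp add: e_def algebra_simps)
  have be: "\<bar>e q\<bar> \<le> 2 * M" for q
    using M[of "q - 1 / 2"] M[of "q + 1 / 2"] by (simp add: e_def)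
  \<comment> \<open>If \<open>q + 1/2\<close> lies beyond the trough, it is reflected there.\<close>
  have ne: "0 \<le> e q" if q: "0 \<le> q" "q \<le> P / 2" for q
  proof (cases "q + 1 / 2 \<le> P / 2")
    case True
    have "f (q + 1 / 2) \<le> f \<bar>q - 1 / 2\<bar>" using q True by (intro dec) auto
    also have "\<dots> = f (q - 1 / 2)" using ev[of "q - 1 / 2"] by (auto simp: abs_if)
    finally show ?thesis by (simp add: e_def)
  next
    case False
    have "f (q + 1 / 2) = f (P - q - 1 / 2)"
      using per[of "- (q + 1 / 2)"] ev[of "q + 1 / 2"] by (simp add: algebra_simps)
    also have "\<dots> \<le> f (q - 1 / 2)" using q False P by (intro dec) auto
    finally show ?thesis by (simp add: e_def)
  qed
  obtain p where p: "p \<in> {1..2}" "\<And>y. y \<in> {1..2} \<Longrightarrow> e p \<le> e y"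
    using continuous_attains_inf[of "{1..2::real}" e] continuous_on_subset[OF ce] by auto
  have ep: "0 < e p"
    using admissible_strictly_decreasing[OF adm, of "p - 1 / 2" "p + 1 / 2"] p(1) P by (simp add: e_def)
  have "coercivity_constant * e p \<le> whitham_op e p"
    by (rule whitham_op_odd_periodic_ge[OF borel_measurable_continuous_onI[OF ce] be oe pe ne P])
       (use p ep in auto)
  also have "whitham_op e p = whitham_op (\<lambda>y. f (y + - (1 / 2))) p - whitham_op (\<lambda>y. f (y + 1 / 2)) p"
    unfolding e_def using whitham_op_diff[of "\<lambda>y. f (y + - (1 / 2))" M "\<lambda>y. f (y + 1 / 2)" p] M by simp
  also have "\<dots> = whitham_op f (p - 1 / 2) - whitham_op f (p + 1 / 2)"
    unfolding whitham_op_translate[symmetric] by simp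
  also have "\<dots> = (\<mu> - f (p - 1 / 2) - f (p + 1 / 2)) * e p"
    unfolding eqn e_def by (simp add: algebra_simps power2_eq_square)
  finally have "coercivity_constant \<le> \<mu> - f (p - 1 / 2) - f (p + 1 / 2)"
    using ep by (simp add: mult_le_cancel_right)
  moreover have "f 3 \<le> f (p - 1 / 2)" "f 3 \<le> f (p + 1 / 2)"
    using p(1) P by (auto intro!: dec)
  ultimately show ?thesis by linarith
qed

text \<open>
  At the crest the steady equation gives \<open>L f(0) = f(0) * (\<mu> - f(0))\<close>, which is nonnegative since
  \<open>0 \<le> f(0) \<le> \<mu> / 2\<close>; a value of \<open>f(3)\<close> far below \<open>- \<mu>\<close> would make the average negative.
\<close>

lemma admissible_value_at_3_ge:
  assumes adm: "admissible_pair P \<eta> f \<mu>" and P: "8 \<le> P"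
  shows "- (\<mu> / 2 * whitham_kernel_mass / whitham_kernel 4) \<le> f 3"
proof (cases "f 3 \<le> 0")
  case True
  have \<mu>: "0 < \<mu>" and \<eta>: "0 < \<eta>" "\<eta> \<le> 1" and f0: "f 0 = \<eta> * \<mu> / 2" and top: "\<And>x. f x \<le> f 0"
    using adm by (auto simp: admissible_pair_def)
  have hoe: "f \<in> hoelder_space (1 / 2)" using adm by (simp add: admissible_pair_def)
  have meas: "f \<in> borel_measurable borel"
    by (rule borel_measurable_continuous_onI[OF continuous_of_hoelder_half[OF hoe]])
  obtain M where M: "\<And>y. \<bar>f y\<bar> \<le> M"
    using hoe by (auto simp: hoelder_space_def bounded_iff)
  have "\<eta> * \<mu> \<le> 1 * \<mu>" using \<eta> \<mu> by (intro mult_right_mono) auto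
  moreover have "0 \<le> \<eta> * \<mu>" using \<eta> \<mu> by simp
  ultimately have f0': "0 \<le> f 0" "f 0 \<le> \<mu> / 2" using f0 by auto
  have "- \<mu> * f 0 + whitham_op f 0 + (f 0)\<^sup>2 = 0"
    using adm unfolding admissible_pair_def steady_whitham_def by blast
  then have "whitham_op f 0 = f 0 * (\<mu> - f 0)" by (simp add: algebra_simps power2_eq_square)
  moreover have "0 \<le> f 0 * (\<mu> - f 0)" using f0' \<mu> by (intro mult_nonneg_nonneg) auto
  ultimately have "0 \<le> whitham_op f 0" by simp
  also have "\<dots> \<le> \<mu> / 2 * whitham_kernel_mass + whitham_kernel 4 * f 3"
  proof (rule whitham_op_le_of_negative_part[OF meas M])
    show "f y \<le> \<mu> / 2" for y using top[of y] f0' by linarith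
    show "f y \<le> f 3" if "3 \<le> y" "y \<le> 4" for y
      using that P by (intro admissible_decreasing[OF adm]) auto
  qed (use \<mu> True in auto)
  finally show ?thesis using whitham_kernel_pos[of 4] by (simp add: field_simps)
next
  case False
  have "0 < \<mu>" using adm by (simp add: admissible_pair_def)
  then have "0 \<le> \<mu> / 2 * whitham_kernel_mass / whitham_kernel 4"
    using whitham_kernel_mass_nonneg whitham_kernel_pos[of 4] by simp
  then show ?thesis using False by linarith
qed

lemma admissible_speed_lower_bound:
  assumes adm: "admissible_pair P \<eta> f \<mu>" and P: "8 \<le> P"
  shows "coercivity_constant / (1 + whitham_kernel_mass / whitham_kernel 4) \<le> \<mu>"
proof -
  have "coercivity_constant \<le> \<mu> * (1 + whitham_kernel_mass / whitham_kernel 4)"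
    using speed_ge_coercivity[OF adm P] admissible_value_at_3_ge[OF adm P] by (simp add: algebra_simps)
  moreover have "0 < 1 + whitham_kernel_mass / whitham_kernel 4"
    using whitham_kernel_mass_nonneg whitham_kernel_pos[of 4] by (intro add_pos_nonneg) auto
  ultimately show ?thesis by (simp add: divide_le_eq)
qed

section \<open>Limiting pairs\<close>

lemma limiting_speed_pos:
  assumes "limiting_pair \<eta> \<phi> \<nu>"
  shows "0 < \<nu>"
proof -
  obtain P f \<mu> where adm: "\<And>n::nat. admissible_pair (P n) \<eta> (f n) (\<mu> n)"
    and P: "filterlim P at_top sequentially" and \<mu>: "\<mu> \<longlonglongrightarrow> \<nu>"
    using assms unfolding limiting_pair_def by blast
  define c where "c = coercivity_constant / (1 + whitham_kernel_mass / whitham_kernel 4)"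
  have "\<forall>\<^sub>F n in sequentially. 8 \<le> P n"
    using P by (simp add: filterlim_at_top)
  then have "\<forall>\<^sub>F n in sequentially. c \<le> \<mu> n"
    by eventually_elim (simp add: c_def admissible_speed_lower_bound[OF adm])
  then have "c \<le> \<nu>" using \<mu> by (intro tendsto_lowerbound[OF \<mu>]) auto
  moreover have "0 < c"
    unfolding c_def using coercivity_constant_pos whitham_kernel_mass_nonneg whitham_kernel_pos[of 4]
    by (intro divide_pos_pos add_pos_nonneg) auto
  ultimately show ?thesis by simp
qed

lemma limiting_value_at_0:
  assumes "limiting_pair \<eta> \<phi> \<nu>"
  shows "\<phi> 0 = \<eta> * \<nu> / 2"
proof -
  obtain P f \<mu> where adm: "\<And>n::nat. admissible_pair (P n) \<eta> (f n) (\<mu> n)"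
    and lim: "uniform_limit {0} f \<phi> sequentially" and \<mu>: "\<mu> \<longlonglongrightarrow> \<nu>"
    using assms unfolding limiting_pair_def by (metis compact_insert compact_empty)
  have "(\<lambda>n. f n 0) \<longlonglongrightarrow> \<phi> 0" by (rule tendsto_uniform_limitI[OF lim]) simp
  moreover have "f n 0 = \<eta> * \<mu> n / 2" for n using adm[of n] by (simp add: admissible_pair_def)
  moreover have "(\<lambda>n. \<eta> * \<mu> n / 2) \<longlonglongrightarrow> \<eta> * \<nu> / 2" by (intro tendsto_intros \<mu>) auto
  ultimately show ?thesis using LIMSEQ_unique by fastforce
qed

theorem proposition4p7:
  fixes \<phi> :: "real \<Rightarrow> real \<Rightarrow> real" and \<nu> :: "real \<Rightarrow> real"
  assumes "\<And>\<eta>. \<eta> \<in> {0<..1} \<Longrightarrow> limiting_pair \<eta> (\<phi> \<eta>) (\<nu> \<eta>)"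
  shows "inj_on (\<lambda>\<eta>. ((\<lambda>x. \<phi> \<eta> x + 1 - \<nu> \<eta>), 2 - \<nu> \<eta>)) {0<..1}"
proof (rule inj_onI)
  fix \<eta> \<theta> :: real
  assume \<eta>: "\<eta> \<in> {0<..1}" and \<theta>: "\<theta> \<in> {0<..1}"
    and eq: "((\<lambda>x. \<phi> \<eta> x + 1 - \<nu> \<eta>), 2 - \<nu> \<eta>) = ((\<lambda>x. \<phi> \<theta> x + 1 - \<nu> \<theta>), 2 - \<nu> \<theta>)"
  have \<nu>: "\<nu> \<eta> = \<nu> \<theta>" using eq by simp
  have "\<phi> \<eta> 0 + 1 - \<nu> \<eta> = \<phi> \<theta> 0 + 1 - \<nu> \<theta>"
    using eq by (auto dest: fun_cong[where x = 0])
  then have "\<phi> \<eta> 0 = \<phi> \<theta> 0" using \<nu> by simp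
  then have "\<eta> * \<nu> \<theta> = \<theta> * \<nu> \<theta>"
    using limiting_value_at_0[OF assms[OF \<eta>]] limiting_value_at_0[OF assms[OF \<theta>]] \<nu> by simp
  moreover have "0 < \<nu> \<theta>" by (rule limiting_speed_pos[OF assms[OF \<theta>]])
  ultimately show "\<eta> = \<theta>" by simp
qed

end
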